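(* Every crowded Tychonov space $X$ has a crowded Tychonov nowhere constant image $Y$ of weight $w(Y)\le\widehat{c}(X)$. If $\mathrm{sh}(X)<\widehat{c}(X)$, in particular if there are no $\widehat{c}(X)$-Suslin trees, then $X$ has a crowded Tychonov nowhere constant image $Y$ of weight $w(Y)<\widehat{c}(X)$.
   Context: A space is crowded if it has no isolated points. $Y$ is a nowhere constant image of $X$ if there is a continuous surjection $f:X\to Y$ with $|f[U]|>1$ for every non-empty open $U\subseteq X$. $w(Y)$ is the weight of $Y$ (minimum cardinality of a base). $\widehat{c}(X)$ is the smallest cardinal $\kappa$ such that there is no family of $\kappa$ many pairwise disjoint non-empty open subsets of $X$. $RO^+(X)$ is the family of non-empty regular open subsets of $X$. A shattering family for $X$ is a set $\mathfrak{F}$ whose members are pairwise disjoint subfamilies of $RO^+(X)$, such that for every non-empty open $U\subseteq X$ there is $\mathcal{S}\in\mathfrak{F}$ such that $U$ intersects at least two members of $\mathcal{S}$; $\mathrm{sh}(X)$ is the minimum cardinality of a shattering family for $X$. A $\kappa$-Suslin tree is a tree of height $\kappa$ in which all chains and all antichains have cardinality $<\kappa$. *)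

theory Defs
  imports "HOL-Analysis.Analysis"
begin

unbundle cardinal_syntax

section \<open>Crowded spaces, Tychonov spaces, nowhere constant images\<close>

definition crowded_space :: "'a topology \<Rightarrow> bool" where
  "crowded_space X \<longleftrightarrow> (\<forall>x\<in>topspace X. \<not> openin X {x})"

definition tychonov_space :: "'a topology \<Rightarrow> bool" where
  "tychonov_space X \<longleftrightarrow> completely_regular_space X \<and> Hausdorff_space X"

definition nowhere_constant_image :: "'a topology \<Rightarrow> 'b topology \<Rightarrow> bool" where
  "nowhere_constant_image X Y \<longleftrightarrow>
     (\<exists>f. continuous_map X Y f \<and> f ` topspace X = topspace Y \<and>
          (\<forall>U. openin X U \<and> U \<noteq> {} \<longrightarrow> (\<exists>x\<in>U. \<exists>y\<in>U. f x \<noteq> f y)))"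

section \<open>Cardinal functions\<close>

text \<open>
  As in the cardinal library, a cardinal is a relation \<open>\<kappa>\<close> with \<open>Card_order \<kappa>\<close>,
  determined only up to \<open>=o\<close>. The lemmas after the definitions show that each of the
  choices made below has a witness.
\<close>

definition base_for :: "'a topology \<Rightarrow> 'a set set \<Rightarrow> bool" where
  "base_for X \<B> \<longleftrightarrow> (\<forall>V\<in>\<B>. openin X V) \<and>
     (\<forall>U x. openin X U \<and> x \<in> U \<longrightarrow> (\<exists>V\<in>\<B>. x \<in> V \<and> V \<subseteq> U))"

definition weight :: "'a topology \<Rightarrow> 'a set rel" where
  "weight X = |SOME \<B>. base_for X \<B> \<and> (\<forall>\<B>'. base_for X \<B>' \<longrightarrow> |\<B>| \<le>o |\<B>'| )|"

definition cellular_family :: "'a topology \<Rightarrow> 'a set set \<Rightarrow> bool" where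
  "cellular_family X \<C> \<longleftrightarrow> (\<forall>U\<in>\<C>. openin X U \<and> U \<noteq> {}) \<and> pairwise disjnt \<C>"

text \<open>
  The type \<open>'a set\<close> is large enough: a cellular family has at most \<open>|topspace X|\<close>
  members, so the successor of that cardinal already admits none. Minimality against cardinals
  on other types is the lemma \<open>hat_c_least\<close>.
\<close>

definition hat_c :: "'a topology \<Rightarrow> 'a set rel" where
  "hat_c X = (SOME \<kappa>. Card_order \<kappa> \<and> \<not> (\<exists>\<C>. cellular_family X \<C> \<and> |\<C>| =o \<kappa>) \<and>
     (\<forall>\<mu> :: 'a set rel. Card_order \<mu> \<and> \<not> (\<exists>\<C>. cellular_family X \<C> \<and> |\<C>| =o \<mu>) \<longrightarrow> \<kappa> \<le>o \<mu>))"

definition RO_plus :: "'a topology \<Rightarrow> 'a set set" where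
  "RO_plus X = {U. openin X U \<and> X interior_of (X closure_of U) = U \<and> U \<noteq> {}}"

text \<open>Disjointness is required within each member \<open>\<S>\<close> of the family, not between members.\<close>

definition shattering_family :: "'a topology \<Rightarrow> 'a set set set \<Rightarrow> bool" where
  "shattering_family X \<FF> \<longleftrightarrow>
     (\<forall>\<S>\<in>\<FF>. \<S> \<subseteq> RO_plus X \<and> pairwise disjnt \<S>) \<and>
     (\<forall>U. openin X U \<and> U \<noteq> {} \<longrightarrow>
        (\<exists>\<S>\<in>\<FF>. \<exists>A\<in>\<S>. \<exists>B\<in>\<S>. A \<noteq> B \<and> U \<inter> A \<noteq> {} \<and> U \<inter> B \<noteq> {}))"

definition sh :: "'a topology \<Rightarrow> 'a set set rel" where
  "sh X = |SOME \<FF>. shattering_family X \<FF> \<and> (\<forall>\<FF>'. shattering_family X \<FF>' \<longrightarrow> |\<FF>| \<le>o |\<FF>'| )|"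

section \<open>Suslin trees\<close>

text \<open>A tree is given by its reflexive order \<open>r\<close>; the set of its nodes is \<open>Field r\<close>.\<close>

definition tree_order :: "'t rel \<Rightarrow> bool" where
  "tree_order r \<longleftrightarrow> Partial_order r \<and> (\<forall>t\<in>Field r. well_order_on (underS r t) (Restr r (underS r t)))"

text \<open>
  The height of a node \<open>t\<close> is the order type of \<open>Restr r (underS r t)\<close>; the height of
  the tree is the least ordinal that is not the height of a node. Every ordinal below
  \<open>\<alpha>\<close> is represented by a well-order on the type that carries \<open>\<alpha>\<close>.
\<close>

definition tree_has_height :: "'t rel \<Rightarrow> 'k rel \<Rightarrow> bool" where
  "tree_has_height r \<alpha> \<longleftrightarrow> Well_order \<alpha> \<and>
     (\<forall>t\<in>Field r. Restr r (underS r t) <o \<alpha>) \<and>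
     (\<forall>\<beta> :: 'k rel. \<beta> <o \<alpha> \<longrightarrow> (\<exists>t\<in>Field r. Restr r (underS r t) =o \<beta>))"

definition Antichains :: "'t rel \<Rightarrow> 't set set" where
  "Antichains r = {A. A \<subseteq> Field r \<and> (\<forall>a\<in>A. \<forall>b\<in>A. a \<noteq> b \<longrightarrow> (a, b) \<notin> r \<and> (b, a) \<notin> r)}"

definition suslin_tree :: "'k rel \<Rightarrow> 't rel \<Rightarrow> bool" where
  "suslin_tree \<kappa> r \<longleftrightarrow> tree_order r \<and> tree_has_height r \<kappa> \<and>
     (\<forall>C\<in>Chains r. |C| <o \<kappa>) \<and> (\<forall>A\<in>Antichains r. |A| <o \<kappa>)"

text \<open>
  The levels of a \<open>\<kappa>\<close>-Suslin tree are antichains, and there are \<open>\<kappa>\<close> of them, so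
  the tree has at most \<open>\<kappa>\<close> nodes. Hence a \<open>\<kappa>\<close>-Suslin tree on any type whatsoever
  has an isomorphic copy on the type that carries \<open>\<kappa>\<close>, and quantifying over trees on that
  type loses nothing.
\<close>

definition no_suslin_trees :: "'k rel \<Rightarrow> bool" where
  "no_suslin_trees \<kappa> \<longleftrightarrow> \<not> (\<exists>r :: 'k rel. suslin_tree \<kappa> r)"

section \<open>The cardinal functions are well defined\<close>

lemma ex_min_card:
  assumes "P (A :: 's set)"
  shows "\<exists>B. P B \<and> (\<forall>B'. P B' \<longrightarrow> |B| \<le>o |B'| )"
proof -
  have "\<exists>r \<in> card_of ` Collect P. \<forall>r' \<in> card_of ` Collect P. r \<le>o r'"
    by (rule exists_minim_Card_order) (use assms in \<open>auto simp: card_of_Card_order\<close>)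
  then show ?thesis by auto
qed

lemma weight_attained: "\<exists>\<B>. base_for X \<B> \<and> weight X = |\<B>|"
  and weight_least: "base_for X \<B> \<Longrightarrow> weight X \<le>o |\<B>|"
proof -
  have "base_for X {U. openin X U}"
    unfolding base_for_def by blast
  from someI_ex[OF ex_min_card[of "base_for X", OF this]]
  show "\<exists>\<B>. base_for X \<B> \<and> weight X = |\<B>|" "base_for X \<B> \<Longrightarrow> weight X \<le>o |\<B>|"
    unfolding weight_def by blast+
qed

lemma card_of_cellular_family:
  assumes "cellular_family X \<C>" shows "|\<C>| \<le>o |topspace X|"
proof -
  define g where "g U = (SOME x. x \<in> U)" for U :: "'a set"
  have g: "g U \<in> U" if "U \<in> \<C>" for U
    using that assms unfolding g_def cellular_family_def by (metis some_in_eq)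
  have "inj_on g \<C>"
    using g assms unfolding inj_on_def cellular_family_def pairwise_def disjnt_iff by metis
  moreover have "g ` \<C> \<subseteq> topspace X"
    using g assms openin_subset unfolding cellular_family_def by fastforce
  ultimately show ?thesis
    using card_of_ordLeq by blast
qed

lemma hat_c_Card_order: "Card_order (hat_c X)"
  and no_cellular_family_hat_c: "cellular_family X \<C> \<Longrightarrow> \<not> |\<C>| =o hat_c X"
  and hat_c_least_same_type:
    "\<lbrakk>Card_order (\<mu> :: 'a set rel); \<not> (\<exists>\<C>. cellular_family X \<C> \<and> |\<C>| =o \<mu>)\<rbrakk> \<Longrightarrow> hat_c X \<le>o \<mu>"
  for X :: "'a topology"
proof -
  let ?R = "{\<kappa> :: 'a set rel. Card_order \<kappa> \<and> \<not> (\<exists>\<C>. cellular_family X \<C> \<and> |\<C>| =o \<kappa>)}"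
  have lt: "|topspace X| <o cardSuc |topspace X|"
    by (simp add: cardSuc_greater card_of_Card_order)
  have "\<not> |\<C>| =o cardSuc |topspace X|" if "cellular_family X \<C>" for \<C>
    using card_of_cellular_family[OF that] lt
    by (meson not_ordLess_ordIso ordLeq_ordLess_trans)
  then have "cardSuc |topspace X| \<in> ?R"
    using cardSuc_Card_order[OF card_of_Card_order] by blast
  then have "\<exists>r \<in> ?R. \<forall>r' \<in> ?R. r \<le>o r'"
    by (intro exists_minim_Card_order) auto
  then have "\<exists>\<kappa> :: 'a set rel. Card_order \<kappa> \<and> \<not> (\<exists>\<C>. cellular_family X \<C> \<and> |\<C>| =o \<kappa>) \<and>
     (\<forall>\<mu> :: 'a set rel. Card_order \<mu> \<and> \<not> (\<exists>\<C>. cellular_family X \<C> \<and> |\<C>| =o \<mu>) \<longrightarrow> \<kappa> \<le>o \<mu>)"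
    unfolding Bex_def Ball_def mem_Collect_eq by simp
  from someI_ex[OF this, folded hat_c_def]
  show "Card_order (hat_c X)" "cellular_family X \<C> \<Longrightarrow> \<not> |\<C>| =o hat_c X"
    "\<lbrakk>Card_order (\<mu> :: 'a set rel); \<not> (\<exists>\<C>. cellular_family X \<C> \<and> |\<C>| =o \<mu>)\<rbrakk> \<Longrightarrow> hat_c X \<le>o \<mu>"
    by blast+
qed

lemma hat_c_least:
  fixes X :: "'a topology" and \<mu> :: "'b rel"
  assumes "Card_order \<mu>" and no: "\<not> (\<exists>\<C>. cellular_family X \<C> \<and> |\<C>| =o \<mu>)"
  shows "hat_c X \<le>o \<mu>"
proof (rule ccontr)
  assume "\<not> hat_c X \<le>o \<mu>"
  then have less: "\<mu> <o hat_c X"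
    using hat_c_Card_order[of X] assms(1) not_ordLeq_iff_ordLess card_order_on_well_order_on by metis
  then have "|Field \<mu>| \<le>o |Field (hat_c X)|"
    using card_of_mono2 ordLess_imp_ordLeq by blast
  then obtain g where g: "inj_on g (Field \<mu>)" "g ` Field \<mu> \<subseteq> Field (hat_c X)"
    unfolding card_of_ordLeq[symmetric] by blast
  have "|g ` Field \<mu>| =o |Field \<mu>|"
    using g(1) card_of_ordIsoI inj_on_imp_bij_betw ordIso_symmetric by blast
  then have iso: "|g ` Field \<mu>| =o \<mu>"
    using card_of_Field_ordIso[OF assms(1)] ordIso_transitive by blast
  then have "\<not> (\<exists>\<C>. cellular_family X \<C> \<and> |\<C>| =o |g ` Field \<mu>| )"
    using no ordIso_transitive by blast
  then have "hat_c X \<le>o |g ` Field \<mu>|"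
    by (intro hat_c_least_same_type card_of_Card_order)
  then show False
    using iso less by (meson not_ordLess_ordLeq ordLeq_ordIso_trans)
qed

lemma ex_shattering_family:
  assumes "crowded_space X" "tychonov_space X"
  shows "\<exists>\<FF>. shattering_family X \<FF>"
proof
  let ?F = "{\<S>. \<S> \<subseteq> RO_plus X \<and> pairwise disjnt \<S>}"
  have "\<exists>\<S>\<in>?F. \<exists>A\<in>\<S>. \<exists>B\<in>\<S>. A \<noteq> B \<and> U \<inter> A \<noteq> {} \<and> U \<inter> B \<noteq> {}"
    if U: "openin X U" "U \<noteq> {}" for U
  proof -
    obtain x where x: "x \<in> U" using U by blast
    then have xt: "x \<in> topspace X" using U openin_subset by blast
    then have "U \<noteq> {x}" using assms U unfolding crowded_space_def by blast
    then obtain y where y: "y \<in> U" "y \<noteq> x" using x by blast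
    then have "y \<in> topspace X" using U openin_subset by blast
    then obtain V W where VW: "openin X V" "openin X W" "x \<in> V" "y \<in> W" "disjnt V W"
      using assms xt y unfolding tychonov_space_def Hausdorff_space_def by metis
    define A where "A = X interior_of (X closure_of V)"
    define B where "B = X interior_of (X closure_of W)"
    have xA: "x \<in> A" and yB: "y \<in> B"
      unfolding A_def B_def using VW
      by (meson closure_of_subset interior_of_maximal openin_subset subsetD)+
    have op: "openin X A" "openin X B" unfolding A_def B_def by auto
    have "X closure_of V \<inter> W = {}"
      using VW by (metis disjnt_def inf_commute openin_Int_closure_of_eq_empty)
    then have "A \<inter> W = {}" unfolding A_def using interior_of_subset by fastforce
    then have "A \<inter> X closure_of W = {}" using op openin_Int_closure_of_eq_empty by metis
    then have dis: "A \<inter> B = {}" unfolding B_def using interior_of_subset by fastforce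
    have regular_open: "X interior_of (X closure_of (X interior_of (X closure_of S))) = X interior_of (X closure_of S)" for S
      by (meson closure_of_closure_of closure_of_mono closure_of_subset interior_of_maximal
          interior_of_mono interior_of_subset openin_interior_of openin_subset subset_antisym
          closedin_closure_of closure_of_minimal)
    have "A \<in> RO_plus X" "B \<in> RO_plus X"
      using op xA yB unfolding RO_plus_def
      by (auto simp: A_def B_def regular_open)
    then have "{A, B} \<in> ?F" using dis by (auto simp: pairwise_def disjnt_def)
    moreover have "A \<noteq> B \<and> U \<inter> A \<noteq> {} \<and> U \<inter> B \<noteq> {}" using xA yB x y dis by auto
    ultimately show ?thesis
      by (intro bexI[of _ "{A, B}"] bexI[of _ A] bexI[of _ B]) simp_all
  qed
  then show "shattering_family X ?F" unfolding shattering_family_def by simp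
qed

lemma sh_attained:
    "\<lbrakk>crowded_space X; tychonov_space X\<rbrakk> \<Longrightarrow> \<exists>\<FF>. shattering_family X \<FF> \<and> sh X = |\<FF>|"
  and sh_least: "shattering_family X \<FF> \<Longrightarrow> sh X \<le>o |\<FF>|"
proof -
  have *: "\<exists>\<FF>. shattering_family X \<FF> \<and> sh X = |\<FF>| \<and> (\<forall>\<FF>'. shattering_family X \<FF>' \<longrightarrow> |\<FF>| \<le>o |\<FF>'| )"
    if "shattering_family X \<FF>0" for \<FF>0
    using someI_ex[OF ex_min_card[of "shattering_family X", OF that]] unfolding sh_def by blast
  show "\<lbrakk>crowded_space X; tychonov_space X\<rbrakk> \<Longrightarrow> \<exists>\<FF>. shattering_family X \<FF> \<and> sh X = |\<FF>|"
    using ex_shattering_family * by blast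
  show "shattering_family X \<FF> \<Longrightarrow> sh X \<le>o |\<FF>|"
    using * by metis
qed

end

theory Submission
  imports Defs
begin

text \<open>
  Let \<open>\<kappa>\<close> be \<open>hat_c X\<close>. Halving regular open sets repeatedly, and taking interiors of
  intersections along branches at limit stages, gives a tree of regular open sets of height at most
  \<open>\<kappa>\<close>. An open set that is not split by any level follows a branch through all levels below
  \<open>\<kappa>\<close>, and the halves leaving that branch would be \<open>\<kappa>\<close> disjoint open sets. So the levels form
  a shattering family; if some level is empty it has fewer than \<open>\<kappa>\<close> members, otherwise the tree is
  a \<open>\<kappa>\<close>-Suslin tree.

  From each member of a shattering family one gets fewer than \<open>\<kappa>\<close> continuous real functions, and
  together these are nonconstant on every nonempty open set; their diagonal map is the required nowhere
  constant map. Strict inequality is preserved because \<open>\<kappa>\<close> is regular (Erdos and Tarski).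
\<close>

section \<open>Cellular families and the regularity of \<open>hat_c\<close>\<close>

text \<open>By Zorn's lemma: a member disjoint from all of a maximal subfamily could be added to it.
  The empty set is excluded because it is disjoint even from itself.\<close>

lemma maximal_disjoint_subfamily:
  assumes "{} \<notin> \<P>"
  obtains \<C> where "\<C> \<subseteq> \<P>" "pairwise disjnt \<C>" "\<And>W. W \<in> \<P> \<Longrightarrow> \<exists>V\<in>\<C>. \<not> disjnt W V"
proof -
  let ?A = "{\<C>. \<C> \<subseteq> \<P> \<and> pairwise disjnt \<C>}"
  have "\<Union>\<K> \<in> ?A" if "subset.chain ?A \<K>" for \<K>
  proof -
    have "pairwise disjnt (\<Union>\<K>)"
      by (rule pairwise_chain_Union) (use that in \<open>auto simp: subset_chain_def chain_subset_def\<close>)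
    with that show ?thesis by (auto simp: subset_chain_def)
  qed
  then have "\<exists>\<C>\<in>?A. \<forall>\<D>\<in>?A. \<C> \<subseteq> \<D> \<longrightarrow> \<D> = \<C>" by (rule subset_Zorn')
  then obtain \<C> where \<C>: "\<C> \<in> ?A" "\<And>\<D>. \<D> \<in> ?A \<Longrightarrow> \<C> \<subseteq> \<D> \<Longrightarrow> \<D> = \<C>"
    by metis
  have "\<exists>V\<in>\<C>. \<not> disjnt W V" if W: "W \<in> \<P>" for W
  proof (rule ccontr)
    assume no: "\<not> (\<exists>V\<in>\<C>. \<not> disjnt W V)"
    then have "insert W \<C> \<in> ?A"
      using \<C>(1) W by (auto simp: pairwise_insert disjnt_sym)
    then have "W \<in> \<C>" using \<C>(2) by blast
    with no have "W = {}" by (auto simp: disjnt_def)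
    with W assms show False by simp
  qed
  with \<C>(1) show thesis using that by blast
qed

lemma cellular_familyD:
  assumes "cellular_family X \<C>"
  shows "V \<in> \<C> \<Longrightarrow> openin X V" "V \<in> \<C> \<Longrightarrow> V \<noteq> {}"
    "\<lbrakk>V \<in> \<C>; W \<in> \<C>; V \<noteq> W\<rbrakk> \<Longrightarrow> V \<inter> W = {}"
  using assms unfolding cellular_family_def pairwise_def disjnt_def by blast+

lemma disjoint_family_on_cellular_family:
  assumes "cellular_family X \<C>" "inj_on v I" "\<And>i. i \<in> I \<Longrightarrow> v i \<in> \<C>"
  shows "disjoint_family_on v I"
  unfolding disjoint_family_on_def
  using cellular_familyD(3)[OF assms(1)] assms(2,3) inj_onD by metis

lemma cellular_family_subset:
  "cellular_family X \<C> \<Longrightarrow> \<D> \<subseteq> \<C> \<Longrightarrow> cellular_family X \<D>"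
  unfolding cellular_family_def by (meson pairwise_subset subsetD)

lemma cellular_family_UN:
  assumes "\<And>i. i \<in> I \<Longrightarrow> cellular_family X (D i)"
    and "\<And>i. i \<in> I \<Longrightarrow> \<Union>(D i) \<subseteq> v i" and "disjoint_family_on v I"
  shows "cellular_family X (\<Union>i\<in>I. D i)"
  unfolding cellular_family_def pairwise_def
proof (intro conjI ballI impI)
  fix V W assume "V \<in> (\<Union>i\<in>I. D i)" "W \<in> (\<Union>i\<in>I. D i)" "V \<noteq> W"
  then obtain i j where ij: "i \<in> I" "j \<in> I" "V \<in> D i" "W \<in> D j" by blast
  show "disjnt V W"
  proof (cases "i = j")
    case True
    then show ?thesis
      using assms(1) ij \<open>V \<noteq> W\<close> unfolding cellular_family_def pairwise_def by blast
  next
    case False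
    then have "v i \<inter> v j = {}" using assms(3) ij unfolding disjoint_family_on_def by blast
    then show ?thesis using assms(2) ij unfolding disjnt_def by blast
  qed
qed (use assms(1) in \<open>auto simp: cellular_family_def\<close>)

text \<open>The definition of \<open>hat_c\<close> only excludes families of exactly that size. A
  larger family would contain a subfamily of exactly that size, which is again cellular.\<close>

lemma cellular_family_less_hat_c:
  assumes "cellular_family X \<C>"
  shows "|\<C>| <o hat_c X"
proof (rule ccontr)
  assume "\<not> |\<C>| <o hat_c X"
  then have le: "hat_c X \<le>o |\<C>|"
    using hat_c_Card_order[of X] card_of_Well_order
    by (meson card_order_on_well_order_on not_ordLeq_iff_ordLess)
  then have "|Field (hat_c X)| \<le>o |\<C>|"
    using hat_c_Card_order card_of_Field_ordIso ordIso_ordLeq_trans by blast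
  then obtain g where g: "inj_on g (Field (hat_c X))" "g ` Field (hat_c X) \<subseteq> \<C>"
    unfolding card_of_ordLeq[symmetric] by blast
  have "|g ` Field (hat_c X)| =o |Field (hat_c X)|"
    using g(1) card_of_ordIsoI inj_on_imp_bij_betw ordIso_symmetric by blast
  then have "|g ` Field (hat_c X)| =o hat_c X"
    using card_of_Field_ordIso[OF hat_c_Card_order] ordIso_transitive by blast
  with no_cellular_family_hat_c cellular_family_subset[OF assms g(2)] show False by blast
qed

section \<open>Cellular families inside an open set, and regularity\<close>

definition has_cells :: "'a topology \<Rightarrow> 'a set \<Rightarrow> 'b set \<Rightarrow> bool" where
  "has_cells X V Z \<longleftrightarrow> (\<exists>\<C>. cellular_family X \<C> \<and> \<Union>\<C> \<subseteq> V \<and> |Z| \<le>o |\<C>| )"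

lemma has_cells_mono:
  "has_cells X V Z \<Longrightarrow> |Z'| \<le>o |Z| \<Longrightarrow> has_cells X V Z'"
  unfolding has_cells_def by (meson ordLeq_transitive)

text \<open>Turns cardinals below \<open>k\<close> into points of \<open>Field k\<close>, so that
  the well-order \<open>k\<close> itself can select least sizes and compare them.\<close>

lemma ordLess_imp_card_of_underS:
  assumes "Card_order k" "|Z| <o k"
  obtains a where "a \<in> Field k" "|Z| =o |underS k a|"
proof -
  have W: "Well_order k" using assms(1) card_order_on_well_order_on by blast
  then obtain a where a: "a \<in> Field k" "|Z| =o Restr k (underS k a)"
    using ordLess_iff_ordIso_Restr card_of_Well_order assms(2) by blast
  have "Field (Restr k (underS k a)) = underS k a"
    using W by (simp add: Field_Restr_ofilter wo_rel.underS_ofilter wo_rel_def)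
  moreover have "Card_order (Restr k (underS k a))"
    using a(2) card_of_Card_order Card_order_ordIso ordIso_symmetric by metis
  ultimately have "|underS k a| =o Restr k (underS k a)"
    using card_of_Field_ordIso by metis
  then have "|Z| =o |underS k a|" using a(2) ordIso_symmetric ordIso_transitive by blast
  with a(1) show thesis using that by blast
qed

text \<open>Here \<open>k\<close> is squeezed to be the successor of an infinite cardinal, and such
  successors are regular.\<close>

lemma stable_if_ordLeq_cardSuc:
  assumes "Card_order k" "|M| <o k" "infinite M" "k \<le>o cardSuc |M|"
  shows "stable k"
proof -
  have "cardSuc |M| \<le>o k"
    using assms(1,2) card_of_Card_order cardSuc_ordLess_ordLeq by blast
  then have "k =o cardSuc |M|" using assms(4) ordIso_iff_ordLeq by blast
  moreover have "stable (cardSuc |M| )"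
  proof (rule regularCard_stable)
    show "Card_order (cardSuc |M| )" by (simp add: cardSuc_Card_order card_of_Card_order)
    show "infinite (Field (cardSuc |M| ))"
      using assms(3) card_of_cardSuc_finite by blast
    show "regularCard (cardSuc |M| )"
      using infinite_cardSuc_regularCard[of "|M|"] assms(3) card_of_Card_order by (metis Field_card_of)
  qed
  ultimately show ?thesis using stable_ordIso1 by blast
qed

text \<open>
  The theorem of Erdos and Tarski. Either some open set has, in each of its nonempty open subsets,
  cellular families of all sizes below \<open>\<kappa>\<close>, and these can be nested; or the sets bounding their
  cellular families below \<open>\<kappa>\<close> are dense, and then \<open>\<kappa>\<close> is a successor.
\<close>

lemma stable_hat_c:
  assumes unc: "|UNIV :: nat set| <o hat_c X"
  shows "stable (hat_c X)"
proof -
  let ?k = "hat_c X"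
  have C: "Card_order ?k" by (rule hat_c_Card_order)
  then have W: "Well_order ?k" using card_order_on_well_order_on by blast
  have infk: "infinite (Field ?k)"
    using card_of_mono2[OF ordLess_imp_ordLeq[OF unc]] card_of_ordLeq_finite
    by (metis Field_card_of infinite_UNIV_nat)
  \<comment> \<open>\<open>Z\<close> only stands for a cardinal below \<open>hat_c X\<close>; the
    type of \<open>Z\<close> is large enough because it is the one carrying
    \<open>hat_c X\<close>.\<close>
  define small where "small V \<longleftrightarrow> openin X V \<and> V \<noteq> {} \<and> (\<exists>Z :: 'a set set. |Z| <o ?k \<and> \<not> has_cells X V Z)" for V
  show ?thesis
  proof (cases "\<exists>V. openin X V \<and> V \<noteq> {} \<and> (\<forall>W\<subseteq>V. \<not> small W)")
    case True
    then obtain V where V: "openin X V" "V \<noteq> {}" "\<And>W. W \<subseteq> V \<Longrightarrow> \<not> small W"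
      by blast
    have rich: "has_cells X W Z" if "openin X W" "W \<noteq> {}" "W \<subseteq> V" "|Z| <o ?k" for W and Z :: "'a set set"
      using V(3)[OF that(3)] that(1,2,4) unfolding small_def by metis
    show ?thesis
      unfolding stable_def
    proof (intro allI impI, elim conjE)
      fix I :: "'a set set" and F :: "'a set \<Rightarrow> 'a set set"
      assume I: "|I| <o ?k" and F: "\<forall>i\<in>I. |F i| <o ?k"
      obtain \<C> where \<C>: "cellular_family X \<C>" "\<Union>\<C> \<subseteq> V" "|I| \<le>o |\<C>|"
        using rich[OF V(1,2) subset_refl I] unfolding has_cells_def by metis
      obtain v where v: "inj_on v I" "v ` I \<subseteq> \<C>"
        using \<C>(3) unfolding card_of_ordLeq[symmetric] by blast
      have dis: "disjoint_family_on v I"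
        using disjoint_family_on_cellular_family[OF \<C>(1) v(1)] v(2) by blast
      have "\<exists>D. cellular_family X D \<and> \<Union>D \<subseteq> v i \<and> |F i| \<le>o |D|" if "i \<in> I" for i
      proof -
        have vi: "v i \<in> \<C>" using v(2) that by blast
        then have viV: "v i \<subseteq> V" using \<C>(2) by blast
        have "has_cells X (v i) (F i)"
          by (rule rich[OF cellular_familyD(1,2)[OF \<C>(1) vi] viV bspec[OF F that]])
        then show ?thesis unfolding has_cells_def .
      qed
      then obtain D where D: "\<And>i. i \<in> I \<Longrightarrow> cellular_family X (D i)"
        "\<And>i. i \<in> I \<Longrightarrow> \<Union>(D i) \<subseteq> v i" "\<And>i. i \<in> I \<Longrightarrow> |F i| \<le>o |D i|"
        by metis
      have "\<exists>g. inj_on g (F i) \<and> g ` F i \<subseteq> D i" if "i \<in> I" for i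
        using D(3)[OF that] unfolding card_of_ordLeq[symmetric] .
      then obtain g where g: "\<And>i. i \<in> I \<Longrightarrow> inj_on (g i) (F i)" "\<And>i. i \<in> I \<Longrightarrow> g i ` F i \<subseteq> D i"
        by metis
      have disD: "D i \<inter> D j = {}" if "i \<in> I" "j \<in> I" "i \<noteq> j" for i j
      proof -
        have "v i \<inter> v j = {}" using dis that unfolding disjoint_family_on_def by blast
        then show ?thesis using D(2)[OF that(1)] D(2)[OF that(2)] cellular_familyD(2)[OF D(1)[OF that(1)]] by blast
      qed
      \<comment> \<open>Each index \<open>i\<close> has its own cell \<open>v i\<close>, with room
        for a copy of \<open>F i\<close>. The cells are disjoint, so these copies combine into one
        cellular family of size at least that of \<open>Sigma I F\<close>.\<close>
      have "inj_on (\<lambda>(i, z). g i z) (Sigma I F)"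
      proof (rule inj_onI, clarify)
        fix i z j w assume a: "i \<in> I" "j \<in> I" "z \<in> F i" "w \<in> F j" "g i z = g j w"
        then have "g i z \<in> D i" "g i z \<in> D j" using g(2)[of i] g(2)[of j] by auto
        then have "i = j" using disD a by blast
        then show "i = j \<and> z = w" using a g(1) inj_onD by metis
      qed
      moreover have "(\<lambda>(i, z). g i z) ` Sigma I F \<subseteq> (\<Union>i\<in>I. D i)"
        using g(2) by (auto simp: image_subset_iff)
      ultimately have "|Sigma I F| \<le>o |\<Union>i\<in>I. D i|"
        using card_of_ordLeq by blast
      then show "|Sigma I F| <o ?k"
        using cellular_family_less_hat_c[OF cellular_family_UN[OF D(1,2) dis]] ordLeq_ordLess_trans by blast
    qed
  next
    case False
    obtain \<V> where \<V>: "\<V> \<subseteq> Collect small" "pairwise disjnt \<V>"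
      "\<And>W. small W \<Longrightarrow> \<exists>V\<in>\<V>. \<not> disjnt W V"
      by (rule maximal_disjoint_subfamily[of "Collect small"]) (auto simp: small_def)
    have cellV: "cellular_family X \<V>"
      using \<V>(1,2) unfolding cellular_family_def small_def by blast
    \<comment> \<open>In this case every nonempty open set contains a small one, so maximality of
      \<open>\<V>\<close> makes its union dense.\<close>
    have meets: "\<exists>V\<in>\<V>. W \<inter> V \<noteq> {}" if W: "openin X W" "W \<noteq> {}" for W
    proof -
      obtain W' where W': "small W'" "W' \<subseteq> W" using False W by blast
      with \<V>(3) show ?thesis unfolding disjnt_def by blast
    qed
    have ex_a: "\<exists>a\<in>Field ?k. \<not> has_cells X V (underS ?k a)" if V: "V \<in> \<V>" for V
    proof -
      obtain Z :: "'a set set" where Z: "|Z| <o ?k" "\<not> has_cells X V Z"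
        using \<V>(1) V unfolding small_def by blast
      then obtain a where a: "a \<in> Field ?k" "|Z| =o |underS ?k a|"
        using ordLess_imp_card_of_underS[OF C] by blast
      with Z has_cells_mono show ?thesis using ordIso_imp_ordLeq by blast
    qed
    have least: "\<exists>a\<in>A. \<forall>b\<in>A. (a, b) \<in> ?k" if "A \<subseteq> Field ?k" "A \<noteq> {}" for A
      using that W by (metis wo_rel.intro wo_rel.minim_in wo_rel.minim_least)
    \<comment> \<open>The indices whose initial segment is too large for \<open>V\<close>. The least
      of them, \<open>al V\<close>, is the threshold of \<open>V\<close>: all segments indexed
      strictly below it still fit.\<close>
    define noc where "noc V = {a \<in> Field ?k. \<not> has_cells X V (underS ?k a)}" for V
    have "\<exists>a\<in>noc V. \<forall>b\<in>noc V. (a, b) \<in> ?k" if "V \<in> \<V>" for V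
      by (rule least) (use ex_a[OF that] in \<open>auto simp: noc_def\<close>)
    then obtain al where al: "\<And>V. V \<in> \<V> \<Longrightarrow> al V \<in> noc V"
      "\<And>V b. V \<in> \<V> \<Longrightarrow> b \<in> noc V \<Longrightarrow> (al V, b) \<in> ?k"
      by metis
    have antisymk: "a = b" if "(a, b) \<in> ?k" "(b, a) \<in> ?k" for a b
      using W that unfolding well_order_on_def linear_order_on_def partial_order_on_def antisym_def by blast
    have transk: "(a, c) \<in> ?k" if "(a, b) \<in> ?k" "(b, c) \<in> ?k" for a b c
      using W that unfolding well_order_on_def linear_order_on_def partial_order_on_def preorder_on_def trans_def by blast
    have totalk: "(a, b) \<in> ?k \<or> (b, a) \<in> ?k" if "a \<in> Field ?k" "b \<in> Field ?k" for a b
      using W that wo_rel.TOTALS unfolding wo_rel_def by blast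
    have below: "has_cells X V (underS ?k b)" if "V \<in> \<V>" "b \<in> underS ?k (al V)" for V b
      using that al(2)[of V b] antisymk unfolding noc_def underS_def Field_def by blast
    have underS_mono: "underS ?k a \<subseteq> underS ?k b" if "(a, b) \<in> ?k" for a b
      using that transk antisymk unfolding underS_def by blast
    show ?thesis
    proof (cases "\<exists>c\<in>Field ?k. \<forall>V\<in>\<V>. (al V, c) \<in> ?k")
      case True
      then obtain c where c: "c \<in> Field ?k" "\<And>V. V \<in> \<V> \<Longrightarrow> (al V, c) \<in> ?k" by blast
      \<comment> \<open>With thresholds bounded by \<open>c\<close>, a cellular family is cut by
        \<open>\<V>\<close> into \<open>|\<V>|\<close> many pieces, each of size at most
        \<open>|underS ?k c|\<close>. The summand \<open>nat\<close> makes \<open>?M\<close>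
        infinite.\<close>
      let ?M = "(\<V> <+> underS ?k c) <+> (UNIV :: nat set)"
      have infM: "infinite ?M" by (simp add: finite_Plus_iff)
      have V_M: "|\<V>| \<le>o |?M|"
        by (rule ordLeq_transitive[OF card_of_Plus1 card_of_Plus1])
      have u_M: "|underS ?k c| \<le>o |?M|"
        by (rule ordLeq_transitive[OF card_of_Plus2 card_of_Plus1])
      have "|?M| <o ?k"
        using infk C unc cellular_family_less_hat_c[OF cellV] card_of_underS[OF C c(1)]
        by (intro card_of_Plus_ordLess_infinite_Field)
      moreover have bound: "|\<C>| \<le>o |?M|" if \<C>: "cellular_family X \<C>" for \<C>
      proof -
        have "\<C> \<subseteq> (\<Union>V\<in>\<V>. {W\<in>\<C>. W \<inter> V \<noteq> {}})"
        proof
          fix W assume "W \<in> \<C>"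
          then show "W \<in> (\<Union>V\<in>\<V>. {W\<in>\<C>. W \<inter> V \<noteq> {}})"
            using meets[OF cellular_familyD(1,2)[OF \<C>]] by auto
        qed
        then have "|\<C>| \<le>o |\<Union>V\<in>\<V>. {W\<in>\<C>. W \<inter> V \<noteq> {}}|" by (rule card_of_mono1)
        also have "|\<Union>V\<in>\<V>. {W\<in>\<C>. W \<inter> V \<noteq> {}}| \<le>o |?M|"
        proof (rule card_of_UNION_ordLeq_infinite[OF infM V_M], rule ballI)
          fix V assume V: "V \<in> \<V>"
          let ?T = "{W\<in>\<C>. W \<inter> V \<noteq> {}}"
          \<comment> \<open>Distinct members have disjoint nonempty traces on \<open>V\<close>, so
            the traces form a cellular family of the same size inside \<open>V\<close>.\<close>
          have inj: "inj_on (\<lambda>W. W \<inter> V) ?T"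
            using cellular_familyD(3)[OF \<C>] unfolding inj_on_def by blast
          have "cellular_family X ((\<lambda>W. W \<inter> V) ` ?T)"
            using cellular_familyD[OF \<C>] cellular_familyD(1)[OF cellV V]
            unfolding cellular_family_def pairwise_def disjnt_def by blast
          moreover have "\<Union>((\<lambda>W. W \<inter> V) ` ?T) \<subseteq> V" by blast
          moreover have "\<not> has_cells X V (underS ?k c)"
            using al(1)[OF V] has_cells_mono[OF _ card_of_mono1[OF underS_mono[OF c(2)[OF V]]]]
            unfolding noc_def by blast
          ultimately have "\<not> |underS ?k c| \<le>o |(\<lambda>W. W \<inter> V) ` ?T|"
            unfolding has_cells_def by blast
          moreover have "|?T| \<le>o |(\<lambda>W. W \<inter> V) ` ?T|"
            using inj card_of_ordLeq by blast
          ultimately have "|?T| \<le>o |underS ?k c|"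
            using ordLeq_total[OF card_of_Well_order card_of_Well_order] ordLeq_transitive by meson
          then show "|?T| \<le>o |?M|" using u_M ordLeq_transitive by blast
        qed
        finally show ?thesis .
      qed
      moreover have "?k \<le>o cardSuc |?M|"
      proof (rule hat_c_least)
        show "\<not> (\<exists>\<C>. cellular_family X \<C> \<and> |\<C>| =o cardSuc |?M| )"
          using bound cardSuc_greater[OF card_of_Card_order, of ?M]
          by (meson not_ordLess_ordIso ordLeq_ordLess_trans)
      qed (simp add: cardSuc_Card_order card_of_Card_order)
      ultimately show ?thesis using infM stable_if_ordLeq_cardSuc[OF C] by blast
    next
      case False
      define N where "N = al ` \<V>"
      have N: "N \<subseteq> Field ?k" using al(1) unfolding N_def noc_def by blast
      have "\<exists>b\<in>{b\<in>N. c \<in> underS ?k b}. \<forall>b'\<in>{b\<in>N. c \<in> underS ?k b}. (b, b') \<in> ?k"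
        if c: "c \<in> Field ?k" for c
      proof (rule least)
        obtain V where V: "V \<in> \<V>" "(al V, c) \<notin> ?k" using False c by blast
        then have "al V \<in> N" unfolding N_def by blast
        moreover have "c \<in> underS ?k (al V)"
          using V totalk[of c "al V"] c N \<open>al V \<in> N\<close> unfolding underS_def by auto
        ultimately show "{b\<in>N. c \<in> underS ?k b} \<noteq> {}" by blast
      qed (use N in blast)
      \<comment> \<open>\<open>N\<close> is the unbounded set of thresholds, and \<open>nx c\<close>
        is the least one strictly above \<open>c\<close>. The shift matters: a set with threshold
        \<open>b\<close> is only known to carry segments indexed strictly below
        \<open>b\<close>.\<close>
      then obtain nx where nx: "\<And>c. c \<in> Field ?k \<Longrightarrow> nx c \<in> N" "\<And>c. c \<in> Field ?k \<Longrightarrow> c \<in> underS ?k (nx c)"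
        "\<And>c b. c \<in> Field ?k \<Longrightarrow> b \<in> N \<Longrightarrow> c \<in> underS ?k b \<Longrightarrow> (nx c, b) \<in> ?k"
        by (metis (mono_tags, lifting) mem_Collect_eq)
      \<comment> \<open>If \<open>b\<close> precedes \<open>b'\<close> in \<open>N\<close>, then
        \<open>nx b\<close> is at most \<open>b'\<close>, hence strictly below \<open>nx b'\<close>.
        So different \<open>b\<close> are assigned different cells \<open>v b\<close>.\<close>
      have nx_less: "nx b \<noteq> nx b'" if "b \<in> N" "b' \<in> N" "b \<in> underS ?k b'" for b b'
      proof
        assume "nx b = nx b'"
        moreover have "b \<in> Field ?k" "b' \<in> Field ?k" using N that by blast+
        ultimately have "(nx b', b') \<in> ?k" "b' \<in> underS ?k (nx b')"
          using nx(3)[of b b'] nx(2)[of b'] that by auto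
        then show False using antisymk unfolding underS_def by blast
      qed
      have inj_nx: "inj_on nx N"
      proof (rule inj_onI, rule ccontr)
        fix b b' assume b: "b \<in> N" "b' \<in> N" "nx b = nx b'" "b \<noteq> b'"
        then have "b \<in> underS ?k b' \<or> b' \<in> underS ?k b"
          using totalk[of b b'] N unfolding underS_def by blast
        then show False using nx_less[of b b'] nx_less[of b' b] b by auto
      qed
      have "\<exists>V\<in>\<V>. al V = nx b" if "b \<in> N" for b
        using nx(1)[of b] that N unfolding N_def by force
      then obtain v where v: "\<And>b. b \<in> N \<Longrightarrow> v b \<in> \<V>" "\<And>b. b \<in> N \<Longrightarrow> al (v b) = nx b"
        by metis
      have dis: "disjoint_family_on v N"
      proof (rule disjoint_family_on_cellular_family[OF cellV _ v(1)])
        show "inj_on v N" using v(2) inj_nx unfolding inj_on_def by metis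
      qed
      have "has_cells X (v b) (underS ?k b)" if "b \<in> N" for b
        using below[OF v(1)] v(2) nx(2) N that by auto
      then obtain D where D: "\<And>b. b \<in> N \<Longrightarrow> cellular_family X (D b)"
        "\<And>b. b \<in> N \<Longrightarrow> \<Union>(D b) \<subseteq> v b" "\<And>b. b \<in> N \<Longrightarrow> |underS ?k b| \<le>o |D b|"
        unfolding has_cells_def by metis
      let ?D = "\<Union>b\<in>N. D b"
      let ?M = "?D <+> (UNIV :: nat set)"
      have D_k: "|?D| <o ?k"
        by (rule cellular_family_less_hat_c[OF cellular_family_UN[OF D(1,2) dis]])
      have M: "infinite ?M" "|?M| <o ?k"
        using infk C unc D_k by (simp_all add: finite_Plus_iff card_of_Plus_ordLess_infinite_Field)
      \<comment> \<open>Every proper initial segment of \<open>?k\<close> embeds in one of the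
        families making up the single cellular family \<open>?D\<close>; hence \<open>?k\<close> is
        at most the successor of \<open>|?M|\<close>.\<close>
      have bound: "|underS ?k c| \<le>o |?M|" if c: "c \<in> Field ?k" for c
      proof -
        have "underS ?k c \<subseteq> underS ?k (nx c)"
          using nx(2)[OF c] underS_mono unfolding underS_def by blast
        then have "|underS ?k c| \<le>o |underS ?k (nx c)|" by (rule card_of_mono1)
        also have "|underS ?k (nx c)| \<le>o |D (nx c)|" using D(3) nx(1) c by blast
        also have "|D (nx c)| \<le>o |?D|" using nx(1)[OF c] by (intro card_of_mono1) blast
        also have "|?D| \<le>o |?M|" by (rule card_of_Plus1)
        finally show ?thesis .
      qed
      have "?k \<le>o cardSuc |?M|"
      proof (rule ccontr)
        let ?S = "Field (cardSuc |?M| )"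
        have cS: "Card_order (cardSuc |?M| )" by (simp add: cardSuc_Card_order card_of_Card_order)
        assume "\<not> ?k \<le>o cardSuc |?M|"
        then have "cardSuc |?M| <o ?k"
          using W cS not_ordLeq_iff_ordLess card_order_on_well_order_on by blast
        then have "|?S| <o ?k" using card_of_Field_ordIso[OF cS] ordIso_ordLess_trans by blast
        then obtain c where c: "c \<in> Field ?k" "|?S| =o |underS ?k c|"
          using ordLess_imp_card_of_underS[OF C] by blast
        then have "cardSuc |?M| \<le>o |?M|"
          using bound card_of_Field_ordIso[OF cS] ordIso_symmetric ordIso_ordLeq_trans by meson
        then show False
          using cardSuc_greater[OF card_of_Card_order, of ?M] not_ordLess_ordLeq by blast
      qed
      then show ?thesis using M stable_if_ordLeq_cardSuc[OF C] by blast
    qed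
  qed
qed

section \<open>The tree of halves\<close>

lemma RO_plus_openin: "A \<in> RO_plus X \<Longrightarrow> openin X A"
  and RO_plus_nonempty: "A \<in> RO_plus X \<Longrightarrow> A \<noteq> {}"
  unfolding RO_plus_def by blast+

lemma interior_of_closure_of_idem:
  "X interior_of (X closure_of (X interior_of (X closure_of S))) = X interior_of (X closure_of S)"
  by (intro subset_antisym)
     (meson closedin_closure_of closure_of_minimal interior_of_mono interior_of_subset,
      meson closure_of_subset interior_of_maximal interior_of_subset_topspace openin_interior_of)

text \<open>Taking the interior of the closure is monotone and fixes every member of
  \<open>\<A>\<close>, so it cannot lead out of the intersection. This provides the limit stages of
  the tree.\<close>

lemma RO_plus_interior_Inter:
  assumes "\<A> \<noteq> {}" "\<A> \<subseteq> RO_plus X" "X interior_of (\<Inter>\<A>) \<noteq> {}"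
  shows "X interior_of (\<Inter>\<A>) \<in> RO_plus X"
proof -
  let ?I = "X interior_of (\<Inter>\<A>)"
  have "X interior_of (X closure_of ?I) \<subseteq> A" if "A \<in> \<A>" for A
  proof -
    have "?I \<subseteq> A" using interior_of_subset[of X "\<Inter>\<A>"] that by blast
    then have "X interior_of (X closure_of ?I) \<subseteq> X interior_of (X closure_of A)"
      by (intro interior_of_mono closure_of_mono)
    also have "\<dots> = A" using assms(2) that unfolding RO_plus_def by blast
    finally show ?thesis .
  qed
  then have "X interior_of (X closure_of ?I) \<subseteq> ?I"
    by (intro interior_of_maximal) auto
  moreover have "?I \<subseteq> X interior_of (X closure_of ?I)"
    by (intro interior_of_maximal closure_of_subset interior_of_subset_topspace) simp
  ultimately show ?thesis using assms(3) unfolding RO_plus_def by auto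
qed

text \<open>The two halves of \<open>A\<close> are complements of each other in the regular open
  algebra of \<open>A\<close>; \<open>subset_half\<close> expresses this without closures.
  \<open>half_subset\<close> is unconditional so that it also applies to empty nodes.\<close>

locale halving =
  fixes X :: "'a topology" and H :: "bool \<Rightarrow> 'a set \<Rightarrow> 'a set"
  assumes half_RO_plus: "A \<in> RO_plus X \<Longrightarrow> H b A \<in> RO_plus X"
    and half_subset: "H b A \<subseteq> A"
    and half_disjoint: "A \<in> RO_plus X \<Longrightarrow> H b A \<inter> H (\<not> b) A = {}"
    and subset_half: "\<lbrakk>A \<in> RO_plus X; openin X U; U \<subseteq> A; U \<inter> H (\<not> b) A = {}\<rbrakk> \<Longrightarrow> U \<subseteq> H b A"
    and nonempty: "topspace X \<noteq> {}"
begin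

lemma topspace_RO_plus: "topspace X \<in> RO_plus X"
  using nonempty unfolding RO_plus_def by simp

text \<open>Keep the \<open>True\<close> half again and again: the \<open>False\<close> halves split
  off on the way are infinitely many disjoint nonempty open sets.\<close>

lemma nat_less_hat_c: "|UNIV :: nat set| <o hat_c X"
proof -
  define A where "A n = (H True ^^ n) (topspace X)" for n
  have A: "A n \<in> RO_plus X" for n
    by (induction n) (simp_all add: A_def topspace_RO_plus half_RO_plus)
  have mono: "A (n + m) \<subseteq> A n" for n m
    by (induction m) (use half_subset in \<open>auto simp: A_def\<close>)
  have disj: "H False (A m) \<inter> H False (A n) = {}" if "m < n" for m n
  proof -
    obtain d where "n = Suc m + d" using \<open>m < n\<close> less_imp_Suc_add by auto
    then have "A n \<subseteq> H True (A m)" using mono[of "Suc m" d] by (simp add: A_def)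
    then show ?thesis using half_disjoint[OF A, of True m] half_subset[of False "A n"] by auto
  qed
  then have disj': "H False (A m) \<inter> H False (A n) = {}" if "m \<noteq> n" for m n
    using that by (metis Int_commute linorder_neqE_nat)
  have ne: "H False (A n) \<noteq> {}" for n using half_RO_plus A RO_plus_nonempty by blast
  have inj: "inj (\<lambda>n. H False (A n))" using disj' ne unfolding inj_def by (metis Int_absorb)
  have "openin X (H False (A n))" for n
    by (rule RO_plus_openin[OF half_RO_plus[OF A]])
  then have "cellular_family X (range (\<lambda>n. H False (A n)))"
    using ne unfolding cellular_family_def pairwise_image disjnt_def
    by (auto simp: pairwise_def disj')
  then have "|range (\<lambda>n. H False (A n))| <o hat_c X" by (rule cellular_family_less_hat_c)
  moreover have "|UNIV :: nat set| \<le>o |range (\<lambda>n. H False (A n))|"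
    using inj card_of_ordLeq by blast
  ultimately show ?thesis using ordLeq_ordLess_trans by blast
qed

end

text \<open>Two points of \<open>A\<close> are separated by open sets \<open>V\<close> and
  \<open>W\<close>. Then \<open>L\<close> is the regularization of \<open>A \<inter> V\<close> and
  \<open>R\<close> its regular open complement in \<open>A\<close>, nonempty because the closure of
  \<open>A \<inter> V\<close> misses \<open>W\<close>.\<close>

lemma ex_halves:
  assumes "crowded_space X" "Hausdorff_space X" "A \<in> RO_plus X"
  shows "\<exists>L R. L \<in> RO_plus X \<and> R \<in> RO_plus X \<and> L \<subseteq> A \<and> R \<subseteq> A \<and> L \<inter> R = {} \<and>
    (\<forall>U. openin X U \<and> U \<subseteq> A \<longrightarrow> (U \<inter> R = {} \<longrightarrow> U \<subseteq> L) \<and> (U \<inter> L = {} \<longrightarrow> U \<subseteq> R))"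
proof -
  have A: "openin X A" "A \<noteq> {}" "X interior_of (X closure_of A) = A"
    using assms(3) unfolding RO_plus_def by auto
  then have At: "A \<subseteq> topspace X" using openin_subset by blast
  obtain x where x: "x \<in> A" using A(2) by blast
  then have "A \<noteq> {x}" using assms(1) A(1) At unfolding crowded_space_def by (metis subsetD)
  then obtain y where y: "y \<in> A" "x \<noteq> y" using x by blast
  then obtain V W where VW: "openin X V" "openin X W" "x \<in> V" "y \<in> W" "disjnt V W"
    using assms(2) x At unfolding Hausdorff_space_def by (metis subsetD)
  define L where "L = X interior_of (X closure_of (A \<inter> V))"
  define R where "R = A - X closure_of L"
  have oL: "openin X L" and rL: "X interior_of (X closure_of L) = L"
    unfolding L_def by (simp_all add: interior_of_closure_of_idem)
  then have Lt: "L \<subseteq> topspace X" using openin_subset by blast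
  have oAV: "openin X (A \<inter> V)" using A VW by blast
  have "A \<inter> V \<subseteq> L"
    unfolding L_def using oAV by (intro interior_of_maximal closure_of_subset openin_subset)
  then have xL: "x \<in> L" using x VW by blast
  have LA: "L \<subseteq> A"
    using interior_of_mono[OF closure_of_mono[of "A \<inter> V" A X]] A(3) unfolding L_def by blast
  have "X closure_of L \<subseteq> X closure_of (A \<inter> V)"
    unfolding L_def by (simp add: closure_of_minimal interior_of_subset)
  moreover have "W \<inter> X closure_of (A \<inter> V) = {}"
    using VW(5) unfolding openin_Int_closure_of_eq_empty[OF VW(2)] disjnt_def by blast
  ultimately have yR: "y \<in> R" using y VW unfolding R_def by blast
  have oR: "openin X R" unfolding R_def using A(1) by (simp add: openin_diff)
  have "X interior_of (X closure_of R) \<subseteq> R"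
  proof -
    have "X interior_of (X closure_of R) \<subseteq> A"
      using interior_of_mono[OF closure_of_mono[of R A X]] A(3) unfolding R_def by blast
    \<comment> \<open>An open set disjoint from a set is disjoint from its closure. This is applied
      twice: to the open set \<open>L\<close> and \<open>R\<close>, then to the interior of the
      closure of \<open>R\<close> and \<open>L\<close>.\<close>
    moreover have "X interior_of (X closure_of R) \<inter> X closure_of L = {}"
    proof -
      have "R \<inter> L = {}" using closure_of_subset[OF Lt] unfolding R_def by blast
      then have "X closure_of R \<inter> L = {}" using openin_Int_closure_of_eq_empty[OF oL] by blast
      then have "X interior_of (X closure_of R) \<inter> L = {}" using interior_of_subset by fastforce
      then show ?thesis by (simp add: openin_Int_closure_of_eq_empty)
    qed
    ultimately show ?thesis unfolding R_def by blast
  qed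
  moreover have "R \<subseteq> X interior_of (X closure_of R)"
    using oR by (intro interior_of_maximal closure_of_subset openin_subset)
  ultimately have RO: "L \<in> RO_plus X" "R \<in> RO_plus X"
    using oL rL oR xL yR unfolding RO_plus_def by auto
  have "U \<subseteq> L" if "openin X U" "U \<subseteq> A" "U \<inter> R = {}" for U
  proof -
    have "U \<subseteq> X closure_of L" using that unfolding R_def by blast
    then show ?thesis using that(1) interior_of_maximal rL by metis
  qed
  moreover have "U \<subseteq> R" if "openin X U" "U \<subseteq> A" "U \<inter> L = {}" for U
    using that openin_Int_closure_of_eq_empty[OF that(1), of L] unfolding R_def by blast
  moreover have "L \<inter> R = {}" using closure_of_subset[OF Lt] unfolding R_def by blast
  moreover have "R \<subseteq> A" unfolding R_def by blast
  ultimately show ?thesis using RO LA by (rule_tac exI[of _ L], rule_tac exI[of _ R]) simp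
qed

lemma ex_halving:
  assumes "crowded_space X" "Hausdorff_space X" "topspace X \<noteq> {}"
  shows "\<exists>H. halving X H"
proof -
  obtain L R where LR: "\<And>A. A \<in> RO_plus X \<Longrightarrow> L A \<in> RO_plus X \<and> R A \<in> RO_plus X \<and> L A \<subseteq> A \<and>
      R A \<subseteq> A \<and> L A \<inter> R A = {} \<and>
    (\<forall>U. openin X U \<and> U \<subseteq> A \<longrightarrow> (U \<inter> R A = {} \<longrightarrow> U \<subseteq> L A) \<and> (U \<inter> L A = {} \<longrightarrow> U \<subseteq> R A))"
    using ex_halves[OF assms(1,2)] by metis
  \<comment> \<open>The value \<open>{}\<close> outside \<open>RO_plus X\<close> serves to make
    \<open>half_subset\<close> hold for all sets.\<close>
  have "halving X (\<lambda>b A. if A \<in> RO_plus X then if b then L A else R A else {})" (is "halving X ?H")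
  proof
    show "topspace X \<noteq> {}" by (rule assms(3))
    show "?H b A \<subseteq> A" for b A using LR[of A] by simp
    fix A b assume A: "A \<in> RO_plus X"
    show "?H b A \<in> RO_plus X" using LR[OF A] A by simp
    show "?H b A \<inter> ?H (\<not> b) A = {}" using LR[OF A] A by (simp add: Int_commute)
    show "U \<subseteq> ?H b A" if "openin X U" "U \<subseteq> A" "U \<inter> ?H (\<not> b) A = {}" for U
      using LR[OF A] A that by (cases b) simp_all
  qed
  then show ?thesis by blast
qed

section \<open>Branches of halves along a well-order\<close>

locale halving_tree = halving X H for X :: "'a topology" and H +
  fixes k :: "'k rel"
  assumes Well_order_k: "Well_order k"
begin

lemma k_antisym: "(a, b) \<in> k \<Longrightarrow> (b, a) \<in> k \<Longrightarrow> a = b"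
  using Well_order_k unfolding well_order_on_def linear_order_on_def partial_order_on_def antisym_def by blast

lemma k_trans: "(a, b) \<in> k \<Longrightarrow> (b, c) \<in> k \<Longrightarrow> (a, c) \<in> k"
  using Well_order_k unfolding well_order_on_def linear_order_on_def partial_order_on_def preorder_on_def trans_def
  by blast

lemma k_total: "a \<in> Field k \<Longrightarrow> b \<in> Field k \<Longrightarrow> (a, b) \<in> k \<or> (b, a) \<in> k"
  using Well_order_k wo_rel.TOTALS unfolding wo_rel_def by blast

lemma k_refl: "a \<in> Field k \<Longrightarrow> (a, a) \<in> k"
  using k_total by blast

lemma k_wf: "wf (k - Id)"
  using Well_order_k unfolding well_order_on_def by blast

lemma underS_trans: "c \<in> underS k b \<Longrightarrow> (b, a) \<in> k \<Longrightarrow> c \<in> underS k a"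
  using k_trans k_antisym unfolding underS_def by blast

lemma k_induct [case_names less]:
  assumes "\<And>a. (\<And>b. b \<in> underS k a \<Longrightarrow> P b) \<Longrightarrow> P a" shows "P a"
  using k_wf by (induction a rule: wf_induct_rule) (use assms in \<open>auto simp: underS_def\<close>)

text \<open>
  One formula covers zero, successors and limits. A node is determined by the restriction of \<open>s\<close> to
  \<open>underS k a\<close>, and it may be empty.
\<close>

definition node :: "('k \<Rightarrow> bool) \<Rightarrow> 'k \<Rightarrow> 'a set" where
  "node s = wfrec (k - Id) (\<lambda>N a. X interior_of \<Inter>(insert (topspace X) ((\<lambda>b. H (s b) (N b)) ` underS k a)))"

lemma node_eq: "node s a = X interior_of \<Inter>(insert (topspace X) ((\<lambda>b. H (s b) (node s b)) ` underS k a))"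
proof -
  have "(\<lambda>b. H (s b) (cut (node s) (k - Id) a b)) ` underS k a = (\<lambda>b. H (s b) (node s b)) ` underS k a"
    by (rule image_cong) (auto simp: underS_def cut_apply)
  then show ?thesis
    using def_wfrec[OF node_def[THEN eq_reflection] k_wf, of s a] by simp
qed

lemma node_subset_half: "b \<in> underS k a \<Longrightarrow> node s a \<subseteq> H (s b) (node s b)"
  using interior_of_subset unfolding node_eq[of s a] by fastforce

lemma node_antimono: "(b, a) \<in> k \<Longrightarrow> node s a \<subseteq> node s b"
  using node_subset_half[of b a s] half_subset[of "s b" "node s b"] unfolding underS_def
  by (cases "b = a") auto

lemma node_cong: "(\<And>b. b \<in> underS k a \<Longrightarrow> s b = t b) \<Longrightarrow> node s a = node t a"
proof (induction a rule: k_induct)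
  case (less a)
  have "node s b = node t b" if "b \<in> underS k a" for b
    using less that underS_trans unfolding underS_def by blast
  then have "(\<lambda>b. H (s b) (node s b)) ` underS k a = (\<lambda>b. H (t b) (node t b)) ` underS k a"
    using less.prems by (intro image_cong) auto
  then show ?case unfolding node_eq[of _ a] by simp
qed

text \<open>A nonempty node has nonempty predecessors, so by induction it is the interior of an
  intersection of regular open sets. The inserted \<open>topspace X\<close> keeps the intersected
  family nonempty at the bottom.\<close>

lemma node_RO_plus: "node s a \<noteq> {} \<Longrightarrow> node s a \<in> RO_plus X"
proof (induction a rule: k_induct)
  case (less a)
  have "H (s b) (node s b) \<in> RO_plus X" if b: "b \<in> underS k a" for b
  proof -
    have "node s a \<subseteq> node s b" using b node_antimono unfolding underS_def by blast
    then show ?thesis using less b half_RO_plus by blast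
  qed
  then show ?case
    using less.prems topspace_RO_plus unfolding node_eq[of s a]
    by (intro RO_plus_interior_Inter) auto
qed

text \<open>By induction \<open>s\<close> and \<open>t\<close> agree below \<open>c\<close>, so
  their nodes at \<open>c\<close> coincide. If they disagreed at \<open>c\<close>, the two meeting
  nodes would lie in opposite halves of this common node.\<close>

lemma node_agree:
  "\<lbrakk>node s a \<inter> node t b \<noteq> {}; c \<in> underS k a; c \<in> underS k b\<rbrakk> \<Longrightarrow> s c = t c"
proof (induction c rule: k_induct)
  case (less c)
  have "node s c = node t c"
  proof (rule node_cong)
    fix d assume d: "d \<in> underS k c"
    then have "d \<in> underS k a" "d \<in> underS k b"
      using less.prems underS_trans unfolding underS_def by blast+
    with less d show "s d = t d" by blast
  qed
  then have sub: "node s a \<subseteq> H (s c) (node s c)" "node t b \<subseteq> H (t c) (node s c)"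
    using node_subset_half less.prems by metis+
  then have "node s c \<in> RO_plus X" using less.prems node_RO_plus half_subset by blast
  then show ?case using sub half_disjoint[of "node s c" "s c"] less.prems by (cases "s c"; cases "t c") auto
qed

text \<open>A point common to both nodes forces the branches to agree below \<open>a\<close>, and
  nothing else enters the node at \<open>a\<close>.\<close>

lemma node_eq_if_meet:
  assumes "(a, b) \<in> k" "node s a \<inter> node t b \<noteq> {}"
  shows "node s a = node t a"
  using node_cong node_agree[OF assms(2)] underS_trans[OF _ assms(1)] by blast

lemma node_strict:
  assumes "b \<in> underS k a" "node s b \<noteq> {}"
  shows "node s a \<noteq> node s b"
proof -
  have "node s b \<in> RO_plus X" using assms node_RO_plus by blast
  then have "H (\<not> s b) (node s b) \<noteq> {}" "H (s b) (node s b) \<inter> H (\<not> s b) (node s b) = {}"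
    using half_RO_plus half_disjoint RO_plus_nonempty by blast+
  then show ?thesis
    using node_subset_half[OF assms(1), of s] half_subset[of "\<not> s b" "node s b"] by blast
qed

text \<open>At each nonempty node of the branch the rejected half is nonempty and disjoint from all
  later nodes, so the rejected halves form a cellular family indexed by \<open>A\<close>.\<close>

lemma branch_less_hat_c:
  assumes "A \<subseteq> Field k" "\<And>a. a \<in> A \<Longrightarrow> node s a \<noteq> {}"
  shows "|A| <o hat_c X"
proof -
  define g where "g a = H (\<not> s a) (node s a)" for a
  have g: "g a \<in> RO_plus X" if "a \<in> A" for a
    using assms(2) that node_RO_plus half_RO_plus unfolding g_def by blast
  have disj: "g a \<inter> g b = {}" if "a \<in> A" "b \<in> underS k a" for a b
  proof -
    have "node s b \<noteq> {}" using that assms(2) node_antimono unfolding underS_def by blast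
    then have "H (s b) (node s b) \<inter> g b = {}"
      using half_disjoint node_RO_plus unfolding g_def by blast
    moreover have "g a \<subseteq> H (s b) (node s b)"
      using node_subset_half[OF that(2), of s] half_subset[of "\<not> s a" "node s a"] unfolding g_def by blast
    ultimately show ?thesis by blast
  qed
  have disj': "g a \<inter> g b = {}" if "a \<in> A" "b \<in> A" "a \<noteq> b" for a b
    using k_total[of a b] disj[of a b] disj[of b a] assms(1) that unfolding underS_def by blast
  have inj: "inj_on g A"
    using disj' g RO_plus_nonempty unfolding inj_on_def by (metis Int_absorb)
  have "cellular_family X (g ` A)"
    using g RO_plus_openin RO_plus_nonempty disj' unfolding cellular_family_def pairwise_def disjnt_def by blast
  then have "|g ` A| <o hat_c X" by (rule cellular_family_less_hat_c)
  moreover have "|A| \<le>o |g ` A|" using inj card_of_ordLeq by blast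
  ultimately show ?thesis using ordLeq_ordLess_trans by blast
qed

text \<open>The halves of the nodes at \<open>a\<close>, that is, the candidates for the nodes just above \<open>a\<close>.\<close>

definition level :: "'k \<Rightarrow> 'a set set" where
  "level a = {H b (node s a) | b s. node s a \<noteq> {}}"

lemma level_RO_plus: "level a \<subseteq> RO_plus X"
  using node_RO_plus half_RO_plus unfolding level_def by blast

lemma level_disjoint:
  assumes "a \<in> Field k" shows "pairwise disjnt (level a)"
  unfolding pairwise_def
proof (intro ballI impI)
  fix A B assume AB: "A \<in> level a" "B \<in> level a" "A \<noteq> B"
  then obtain b s c t where st: "A = H b (node s a)" "B = H c (node t a)" "node s a \<noteq> {}"
    unfolding level_def by blast
  show "disjnt A B"
  proof (rule ccontr)
    assume "\<not> disjnt A B"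
    then have meet: "A \<inter> B \<noteq> {}" unfolding disjnt_def .
    then have "node s a \<inter> node t a \<noteq> {}" using st half_subset by blast
    then have eq: "node s a = node t a" using node_eq_if_meet k_refl assms by blast
    then have "b \<noteq> c" using AB(3) st(1,2) by fastforce
    then have "c = (\<not> b)" by auto
    with meet eq st(1,2) have "H b (node s a) \<inter> H (\<not> b) (node s a) \<noteq> {}" by simp
    then show False using half_disjoint node_RO_plus[OF st(3)] by blast
  qed
qed

text \<open>An unsplit \<open>U\<close> inside a node must lie in one of its two halves; following
  that half at every stage, and using that \<open>U\<close> is open at limits, keeps
  \<open>U\<close> inside the branch.\<close>

lemma unsplit_imp_branch:
  assumes U: "openin X U" "U \<noteq> {}"
    and unsplit: "\<And>a A B. \<lbrakk>a \<in> Field k; A \<in> level a; B \<in> level a; A \<noteq> B\<rbrakk> \<Longrightarrow> U \<inter> A = {} \<or> U \<inter> B = {}"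
  shows "\<exists>s. \<forall>a. U \<subseteq> node s a"
proof -
  define s where "s b \<longleftrightarrow> (\<exists>t. U \<subseteq> H True (node t b))" for b
  have "U \<subseteq> node s a" for a
  proof (induction a rule: k_induct)
    case (less a)
    have "U \<subseteq> H (s b) (node s b)" if b: "b \<in> underS k a" for b
    proof -
      let ?A = "node s b"
      have bF: "b \<in> Field k" using b unfolding underS_def Field_def by blast
      have UA: "U \<subseteq> ?A" using less b by blast
      then have A: "?A \<in> RO_plus X" "?A \<noteq> {}" using U node_RO_plus by blast+
      show ?thesis
      proof (cases "s b")
        case True
        then obtain t where t: "U \<subseteq> H True (node t b)" unfolding s_def by blast
        then have "node t b \<inter> ?A \<noteq> {}" using UA U half_subset by blast
        then have "node t b = ?A" using node_eq_if_meet k_refl bF by blast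
        with t True show ?thesis by simp
      next
        case False
        then have "\<not> U \<subseteq> H True ?A" unfolding s_def by blast
        \<comment> \<open>Since \<open>U\<close> is not inside the \<open>True\<close> half it meets
          the \<open>False\<close> half; being unsplit, it then misses the \<open>True\<close> half
          and so lies in the \<open>False\<close> half.\<close>
        then have "U \<inter> H False ?A \<noteq> {}" using subset_half[OF A(1) U(1) UA, of True] by auto
        moreover have "H True ?A \<in> level b" "H False ?A \<in> level b" using A unfolding level_def by blast+
        moreover have "H True ?A \<noteq> H False ?A"
          using half_disjoint[OF A(1), of True] RO_plus_nonempty[OF half_RO_plus[OF A(1)], of True] by auto
        ultimately have "U \<inter> H True ?A = {}" using unsplit[OF bF] by blast
        then show ?thesis using subset_half[OF A(1) U(1) UA, of False] False by simp
      qed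
    qed
    then show ?case
      unfolding node_eq[of s a] using U(1) openin_subset[OF U(1)] by (intro interior_of_maximal) auto
  qed
  then show ?thesis by blast
qed

text \<open>Levels outside \<open>J\<close> are empty and split nothing, so an open set unsplit by
  \<open>J\<close> would lie on a branch as long as \<open>Field k\<close>. The set \<open>J\<close>
  is later all of \<open>Field k\<close>, or a proper initial segment.\<close>

lemma shattering_family_levels:
  assumes "J \<subseteq> Field k" "\<not> |Field k| <o hat_c X" "\<And>a s. a \<in> Field k - J \<Longrightarrow> node s a = {}"
  shows "shattering_family X (level ` J)"
  unfolding shattering_family_def
proof (intro conjI allI impI ballI)
  fix \<S> assume "\<S> \<in> level ` J"
  then show "\<S> \<subseteq> RO_plus X" "pairwise disjnt \<S>"
    using level_RO_plus level_disjoint assms(1) by blast+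
next
  fix U assume U: "openin X U \<and> U \<noteq> {}"
  show "\<exists>\<S>\<in>level ` J. \<exists>A\<in>\<S>. \<exists>B\<in>\<S>. A \<noteq> B \<and> U \<inter> A \<noteq> {} \<and> U \<inter> B \<noteq> {}"
  proof (rule ccontr)
    assume no: "\<not> ?thesis"
    have "U \<inter> A = {} \<or> U \<inter> B = {}" if "a \<in> Field k" "A \<in> level a" "B \<in> level a" "A \<noteq> B" for a A B
    proof -
      have "a \<in> J" using assms(3) that unfolding level_def by blast
      with no that show ?thesis by blast
    qed
    then obtain s where "\<And>a. U \<subseteq> node s a" using unsplit_imp_branch[of U] U by metis
    then have "node s a \<noteq> {}" for a using U by (metis subset_empty)
    then show False using branch_less_hat_c[of "Field k" s] assms(2) by blast
  qed
qed

section \<open>The nodes as a tree: heights, chains and antichains\<close>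

definition nodes :: "'a set set" where
  "nodes = {node s a | s a. a \<in> Field k \<and> node s a \<noteq> {}}"

text \<open>The nodes are subsets of the space, so this order lives on the type that carries
  \<open>hat_c X\<close>, as \<open>no_suslin_trees (hat_c X)\<close> demands of the trees it
  excludes.\<close>

definition node_order :: "'a set rel" where
  "node_order = {(A, B). A \<in> nodes \<and> B \<in> nodes \<and> B \<subseteq> A}"

lemma Field_node_order: "Field node_order = nodes"
  unfolding node_order_def Field_def by blast

text \<open>For indices \<open>a\<close> and \<open>b\<close> with \<open>(a, b)\<close> in
  \<open>k\<close>, meeting makes the node at \<open>a\<close> part of the branch of the other node,
  and nodes decrease along a branch.\<close>

lemma nodes_meet_imp_comparable:
  assumes "A \<in> nodes" "B \<in> nodes" "A \<inter> B \<noteq> {}"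
  shows "(A, B) \<in> node_order \<or> (B, A) \<in> node_order"
proof -
  obtain s a t b where st: "A = node s a" "B = node t b" "a \<in> Field k" "b \<in> Field k"
    using assms unfolding nodes_def by blast
  have "A \<subseteq> B \<or> B \<subseteq> A"
    using k_total[OF st(3,4)] node_eq_if_meet[of a b s t] node_eq_if_meet[of b a t s]
      node_antimono[of a b t] node_antimono[of b a s] assms(3) st by blast
  then show ?thesis using assms unfolding node_order_def by blast
qed

lemma node_subset_iff:
  assumes "a \<in> Field k" "b \<in> Field k" "node s b \<noteq> {}"
  shows "node s b \<subseteq> node s a \<longleftrightarrow> (a, b) \<in> k"
  using node_antimono[of a b s] node_antimono[of b a s] node_strict[of b a s] k_total[OF assms(1,2)] assms
  unfolding underS_def by blast

text \<open>A node containing \<open>node s a\<close> meets it and therefore belongs to the same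
  branch, at an index strictly below \<open>a\<close> unless the two are equal.\<close>

lemma underS_node_order:
  assumes a: "a \<in> Field k" "node s a \<noteq> {}"
  shows "underS node_order (node s a) = node s ` underS k a"
proof (intro subset_antisym subsetI)
  fix B assume "B \<in> underS node_order (node s a)"
  then obtain t b where B: "B = node t b" "b \<in> Field k" "node s a \<subseteq> B" "B \<noteq> node s a"
    unfolding underS_def node_order_def nodes_def by blast
  then have meet: "node t b \<inter> node s a \<noteq> {}" using a by blast
  have "\<not> (a, b) \<in> k"
    using node_eq_if_meet[of a b s t] node_antimono[of a b t] meet B by blast
  then have "b \<in> underS k a" using k_total[of a b] a B k_refl unfolding underS_def by blast
  moreover have "B = node s b" using node_eq_if_meet[of b a t s] meet B calculation unfolding underS_def by blast
  ultimately show "B \<in> node s ` underS k a" by blast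
next
  fix B assume "B \<in> node s ` underS k a"
  then obtain b where b: "b \<in> underS k a" "B = node s b" by blast
  then have "b \<in> Field k" "(b, a) \<in> k" unfolding underS_def Field_def by blast+
  moreover have "node s a \<subseteq> node s b" using node_antimono calculation by blast
  moreover have "node s a \<noteq> node s b" using node_strict b(1) a calculation by blast
  ultimately show "B \<in> underS node_order (node s a)"
    using a b unfolding underS_def node_order_def nodes_def by blast
qed

text \<open>Along one branch inclusion of nonempty nodes reflects the order of the indices, so
  \<open>node s\<close> transports \<open>underS k a\<close> onto the predecessors of the node.
  Heights in the tree can thus be read off from \<open>k\<close>.\<close>

lemma Restr_node_order:
  assumes a: "a \<in> Field k" "node s a \<noteq> {}"
  shows "Restr node_order (underS node_order (node s a)) = dir_image (Restr k (underS k a)) (node s)"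
proof -
  have ne: "node s b \<noteq> {}" "b \<in> Field k" if "b \<in> underS k a" for b
    using that node_antimono[of b a s] a unfolding underS_def Field_def by blast+
  have "(node s b, node s c) \<in> node_order \<longleftrightarrow> (b, c) \<in> k" if "b \<in> underS k a" "c \<in> underS k a" for b c
    using node_subset_iff[of b c s] ne that unfolding node_order_def nodes_def by blast
  then show ?thesis
    unfolding underS_node_order[OF a] dir_image_def by blast
qed

lemma Well_order_Restr_underS: "Well_order (Restr k (underS k a))"
  using Well_order_k by (rule Well_order_Restr)

lemma inj_on_node:
  assumes a: "a \<in> Field k" "node s a \<noteq> {}"
  shows "inj_on (node s) (Field (Restr k (underS k a)))"
proof (rule inj_onI)
  fix b c assume bc: "b \<in> Field (Restr k (underS k a))" "c \<in> Field (Restr k (underS k a))" "node s b = node s c"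
  then have "b \<in> underS k a" "c \<in> underS k a" unfolding Field_def by blast+
  then have *: "(b, a) \<in> k" "(c, a) \<in> k" "b \<in> Field k" "c \<in> Field k" unfolding underS_def Field_def by blast+
  then have "node s b \<noteq> {}" "node s c \<noteq> {}" using node_antimono a by blast+
  then have "(b, c) \<in> k" "(c, b) \<in> k" using node_subset_iff * bc(3) by blast+
  then show "b = c" by (rule k_antisym)
qed

lemma height_of_node:
  assumes "a \<in> Field k" "node s a \<noteq> {}"
  shows "Restr node_order (underS node_order (node s a)) =o Restr k (underS k a)"
  unfolding Restr_node_order[OF assms]
  by (rule ordIso_symmetric[OF dir_image_ordIso[OF Well_order_Restr_underS inj_on_node[OF assms]]])

lemma tree_order_node_order: "tree_order node_order"
  unfolding tree_order_def
proof (intro conjI ballI)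
  show "Partial_order node_order"
    unfolding partial_order_on_def preorder_on_def Field_node_order
    by (auto simp: refl_on_def trans_def antisym_def node_order_def)
  fix A assume "A \<in> Field node_order"
  then obtain s a where A: "A = node s a" "a \<in> Field k" "node s a \<noteq> {}"
    unfolding Field_node_order nodes_def by blast
  have "Well_order (Restr node_order (underS node_order A))"
    unfolding A(1) Restr_node_order[OF A(2,3)]
    by (intro Well_order_dir_image Well_order_Restr_underS inj_on_node A)
  moreover have "Field (Restr node_order (underS node_order A)) = underS node_order A"
    unfolding Field_def underS_def node_order_def by blast
  ultimately show "well_order_on (underS node_order A) (Restr node_order (underS node_order A))" by simp
qed

text \<open>Members of a chain are nonempty and comparable, so they meet and their branches agree on
  common predecessors. Gluing these branches puts the whole chain on a single branch.\<close>

lemma chain_less_hat_c: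
  assumes C: "C \<in> Chains node_order"
  shows "|C| <o hat_c X"
proof -
  have chain: "(A, B) \<in> node_order \<or> (B, A) \<in> node_order" if "A \<in> C" "B \<in> C" for A B
    using C that unfolding Chains_def by blast
  then have "C \<subseteq> nodes" unfolding node_order_def by blast
  then have "\<forall>A\<in>C. \<exists>s a. A = node s a \<and> a \<in> Field k \<and> node s a \<noteq> {}" unfolding nodes_def by blast
  then obtain \<sigma> \<alpha> where \<sigma>: "\<And>A. A \<in> C \<Longrightarrow> node (\<sigma> A) (\<alpha> A) = A" "\<And>A. A \<in> C \<Longrightarrow> \<alpha> A \<in> Field k"
    "\<And>A. A \<in> C \<Longrightarrow> A \<noteq> {}"
    by metis
  \<comment> \<open>Any member whose index lies above \<open>b\<close> may dictate the value at
    \<open>b\<close>, by \<open>node_agree\<close>. Where there is no such member the value is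
    arbitrary.\<close>
  define s where "s b = \<sigma> (SOME A. A \<in> C \<and> b \<in> underS k (\<alpha> A)) b" for b
  have node_s: "node s (\<alpha> A) = A" if A: "A \<in> C" for A
  proof -
    have "node s (\<alpha> A) = node (\<sigma> A) (\<alpha> A)"
    proof (rule node_cong)
      fix b assume b: "b \<in> underS k (\<alpha> A)"
      let ?B = "SOME A. A \<in> C \<and> b \<in> underS k (\<alpha> A)"
      have B: "?B \<in> C \<and> b \<in> underS k (\<alpha> ?B)" by (rule someI[of _ A]) (use A b in blast)
      have "?B \<inter> A \<noteq> {}"
        using chain[OF A, of ?B] B \<sigma>(3)[OF A] \<sigma>(3)[of ?B] unfolding node_order_def by blast
      then have "\<sigma> ?B b = \<sigma> A b"
        using node_agree[of "\<sigma> ?B" "\<alpha> ?B" "\<sigma> A" "\<alpha> A" b] B b A \<sigma>(1) by simp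
      then show "s b = \<sigma> A b" unfolding s_def .
    qed
    then show ?thesis using \<sigma>(1) A by simp
  qed
  have "|\<alpha> ` C| <o hat_c X"
    by (rule branch_less_hat_c[of _ s]) (use \<sigma> node_s in auto)
  moreover have "|C| \<le>o |\<alpha> ` C|"
  proof -
    have "inj_on \<alpha> C" using node_s inj_on_def by metis
    then show ?thesis using card_of_ordLeq by blast
  qed
  ultimately show ?thesis using ordLeq_ordLess_trans by blast
qed

text \<open>Incomparable nodes are disjoint, so an antichain is a cellular family.\<close>

lemma antichain_less_hat_c:
  assumes "C \<in> Antichains node_order"
  shows "|C| <o hat_c X"
proof (rule cellular_family_less_hat_c)
  have C: "C \<subseteq> nodes" using assms unfolding Antichains_def Field_node_order by blast
  then have "openin X A \<and> A \<noteq> {}" if "A \<in> C" for A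
    using that node_RO_plus RO_plus_openin unfolding nodes_def by blast
  moreover have "pairwise disjnt C"
    using assms nodes_meet_imp_comparable C unfolding Antichains_def pairwise_def disjnt_def by blast
  ultimately show "cellular_family X C" unfolding cellular_family_def by blast
qed

text \<open>The heights of nodes are the order types of the segments \<open>underS k a\<close>,
  which represent exactly the ordinals below \<open>k\<close>. Nonempty nodes at every index make
  all of them occur.\<close>

lemma tree_has_height_node_order:
  assumes "Field k \<noteq> {}" "\<And>a. a \<in> Field k \<Longrightarrow> \<exists>s. node s a \<noteq> {}"
  shows "tree_has_height node_order k"
  unfolding tree_has_height_def
proof (intro conjI ballI allI impI)
  show "Well_order k" by (rule Well_order_k)
  fix A assume "A \<in> Field node_order"
  then obtain s a where A: "A = node s a" "a \<in> Field k" "node s a \<noteq> {}"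
    unfolding Field_node_order nodes_def by blast
  then show "Restr node_order (underS node_order A) <o k"
    using height_of_node[of a s] underS_Restr_ordLess[OF Well_order_k assms(1), of a] ordIso_ordLess_trans by blast
next
  fix \<beta> :: "'k rel" assume \<beta>: "\<beta> <o k"
  then have "Well_order \<beta>" unfolding ordLess_def by blast
  then obtain a where a: "a \<in> Field k" "\<beta> =o Restr k (underS k a)"
    using \<beta> ordLess_iff_ordIso_Restr[OF Well_order_k] by blast
  then obtain s where "node s a \<noteq> {}" using assms(2) by blast
  then have "node s a \<in> Field node_order" "Restr node_order (underS node_order (node s a)) =o \<beta>"
    using a height_of_node[of a s] ordIso_symmetric ordIso_transitive
    unfolding Field_node_order nodes_def by blast+
  then show "\<exists>t\<in>Field node_order. Restr node_order (underS node_order t) =o \<beta>" by blast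
qed

end

text \<open>The tree is built along \<open>hat_c X\<close> itself. All its levels together shatter;
  without Suslin trees the levels up to some empty one already do.\<close>

lemma sh_hat_c_halving:
  fixes X :: "'a topology"
  assumes "halving X H"
  shows "sh X \<le>o hat_c X" "no_suslin_trees (hat_c X) \<Longrightarrow> sh X <o hat_c X"
proof -
  have C: "Card_order (hat_c X)" by (rule hat_c_Card_order)
  interpret halving_tree X H "hat_c X"
    using assms C card_order_on_well_order_on
    by (simp add: halving_tree_def halving_tree_axioms_def)
  have F: "|Field (hat_c X)| =o hat_c X" by (rule card_of_Field_ordIso[OF C])
  then have nF: "\<not> |Field (hat_c X)| <o hat_c X" using not_ordLess_ordIso by blast
  have "sh X \<le>o |level ` Field (hat_c X)|"
    by (rule sh_least[OF shattering_family_levels[OF subset_refl nF]]) blast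
  also have "|level ` Field (hat_c X)| \<le>o |Field (hat_c X)|" by (rule card_of_image)
  finally show "sh X \<le>o hat_c X" using F ordLeq_ordIso_trans by blast
  assume no: "no_suslin_trees (hat_c X)"
  have ne: "Field (hat_c X) \<noteq> {}"
    using card_of_mono2[OF ordLess_imp_ordLeq[OF nat_less_hat_c]] card_of_ordLeq_finite
    by (metis Field_card_of finite.emptyI infinite_UNIV_nat)
  \<comment> \<open>Chains and antichains are always small enough, so the height is the only
    condition for a Suslin tree that can fail.\<close>
  have "\<not> tree_has_height node_order (hat_c X)"
    using no tree_order_node_order chain_less_hat_c antichain_less_hat_c
    unfolding no_suslin_trees_def suslin_tree_def by blast
  then obtain a where a: "a \<in> Field (hat_c X)" "\<And>s. node s a = {}"
    using tree_has_height_node_order ne by blast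
  \<comment> \<open>Emptiness is inherited upwards, so the nonempty levels are indexed by
    \<open>underS (hat_c X) a\<close>, which has fewer than \<open>hat_c X\<close> elements.\<close>
  have "node s b = {}" if "b \<in> Field (hat_c X) - underS (hat_c X) a" for b s
  proof -
    have "(a, b) \<in> hat_c X" using k_total[of a b] k_refl that a unfolding underS_def by blast
    then show ?thesis using node_antimono a(2) by blast
  qed
  then have "sh X \<le>o |level ` underS (hat_c X) a|"
    by (intro sh_least shattering_family_levels nF) (auto simp: underS_def Field_def)
  also have "|level ` underS (hat_c X) a| \<le>o |underS (hat_c X) a|" by (rule card_of_image)
  also have "|underS (hat_c X) a| <o hat_c X" by (rule card_of_underS[OF C a(1)])
  finally show "sh X <o hat_c X" .
qed

section \<open>Nowhere constant images from real functions\<close>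

text \<open>Sort the finite subsets by size: a set of size \<open>Suc n\<close> arises by inserting
  a point into one of size \<open>n\<close>, so each class stays within \<open>|M|\<close>, and so
  does their countable union.\<close>

lemma card_of_Fpow_ordLeq:
  assumes M: "infinite M" and P: "|P| \<le>o |M|"
  shows "|Fpow P| \<le>o |M|"
proof -
  define F where "F n = {B \<in> Fpow P. card B = n}" for n
  have F: "|F n| \<le>o |M|" for n
  proof (induction n)
    case 0
    have "F 0 \<subseteq> {{}}" unfolding F_def Fpow_def by auto
    then have "finite (F 0)" using finite_subset by blast
    then show ?case
      using M finite_ordLess_infinite[OF card_of_Well_order card_of_Well_order, of "F 0" M]
      by (simp add: Field_card_of ordLess_imp_ordLeq)
  next
    case (Suc n)
    have "F (Suc n) \<subseteq> (\<lambda>(a, B). insert a B) ` (P \<times> F n)"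
    proof
      fix B assume B: "B \<in> F (Suc n)"
      then have "card B = Suc n" "finite B" "B \<subseteq> P" unfolding F_def Fpow_def by auto
      then obtain a B' where "B = insert a B'" "a \<notin> B'" "card B' = n" by (metis card_Suc_eq)
      with \<open>finite B\<close> \<open>B \<subseteq> P\<close> show "B \<in> (\<lambda>(a, B). insert a B) ` (P \<times> F n)"
        unfolding F_def Fpow_def by auto
    qed
    then have "|F (Suc n)| \<le>o |P \<times> F n|"
      using card_of_mono1 card_of_image ordLeq_transitive by metis
    also have "|P \<times> F n| \<le>o |M|"
      using M P Suc by (intro card_of_Times_ordLeq_infinite_Field) (simp_all add: Field_card_of card_of_card_order_on)
    finally show ?case .
  qed
  have "Fpow P = (\<Union>n. F n)" unfolding F_def by blast
  moreover have "|\<Union>n. F n| \<le>o |M|"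
    using M F by (intro card_of_UNION_ordLeq_infinite) (simp_all add: infinite_iff_card_of_nat[symmetric])
  ultimately show ?thesis by simp
qed

text \<open>The preimage of an isolated point would be a nonempty open set on which the map is
  constant.\<close>

lemma crowded_space_nowhere_constant_image:
  assumes "nowhere_constant_image X Y" shows "crowded_space Y"
  unfolding crowded_space_def
proof (intro ballI notI)
  fix y assume y: "y \<in> topspace Y" "openin Y {y}"
  obtain f where f: "continuous_map X Y f" "f ` topspace X = topspace Y"
    "\<And>U. openin X U \<Longrightarrow> U \<noteq> {} \<Longrightarrow> \<exists>x\<in>U. \<exists>z\<in>U. f x \<noteq> f z"
    using assms unfolding nowhere_constant_image_def by metis
  let ?U = "{x \<in> topspace X. f x \<in> {y}}"
  have "openin X ?U" by (rule openin_continuous_map_preimage[OF f(1) y(2)])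
  moreover obtain x where "x \<in> topspace X" "f x = y" using f(2) y(1) by (metis imageE)
  then have "?U \<noteq> {}" by blast
  ultimately show False using f(3) by fastforce
qed

lemma open_real_rational_interval:
  assumes "open S" "x \<in> S"
  obtains a b :: rat where "of_rat a < x" "x < of_rat b" "{of_rat a<..<of_rat b} \<subseteq> (S :: real set)"
proof -
  obtain d where d: "d > 0" "ball x d \<subseteq> S" using assms openE by blast
  obtain a b where ab: "x - d < of_rat a" "of_rat a < x" "x < of_rat b" "of_rat b < x + d"
    using of_rat_dense[of "x - d" x] of_rat_dense[of x "x + d"] d(1) by auto
  then have "{of_rat a<..<of_rat b} \<subseteq> ball x d" by (auto simp: dist_real_def)
  with ab d(2) show thesis using that by blast
qed

text \<open>The diagonal map \<open>e\<close> into a power of the reals does what is wanted, up to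
  the type of its image. A copy of that image is therefore placed on points of \<open>X\<close>, and
  finitely many rational conditions on the coordinates describe a base.\<close>

lemma ex_nowhere_constant_image:
  fixes X :: "'a topology" and \<Phi> :: "('a \<Rightarrow> real) set"
  assumes cont: "\<And>f. f \<in> \<Phi> \<Longrightarrow> continuous_map X euclideanreal f"
    and nonconst: "\<And>U. \<lbrakk>openin X U; U \<noteq> {}\<rbrakk> \<Longrightarrow> \<exists>f\<in>\<Phi>. \<exists>x\<in>U. \<exists>y\<in>U. f x \<noteq> f y"
  obtains Y :: "'a topology" where "tychonov_space Y" "nowhere_constant_image X Y"
    "weight Y \<le>o |\<Phi> <+> (UNIV :: nat set)|"
proof -
  define e where "e x = (\<lambda>f\<in>\<Phi>. f x)" for x :: 'a
  let ?P = "powertop_real \<Phi>"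
  have e_cont: "continuous_map X ?P e"
    unfolding continuous_map_componentwise
    using cont by (auto simp: e_def)
  \<comment> \<open>\<open>r\<close> chooses one point in each fibre of \<open>e\<close>. On the
    chosen points \<open>e\<close> is injective, and the topology pulled back along \<open>e\<close>
    makes them a copy of the image.\<close>
  define r where "r x = (SOME z. z \<in> topspace X \<and> e z = e x)" for x
  have r: "r x \<in> topspace X" "e (r x) = e x" if "x \<in> topspace X" for x
    using someI[of "\<lambda>z. z \<in> topspace X \<and> e z = e x" x] that unfolding r_def by auto
  have r_eq: "e x = e y \<Longrightarrow> r x = r y" for x y unfolding r_def by simp
  define R where "R = r ` topspace X"
  define Y where "Y = pullback_topology R e ?P"
  have RX: "R \<subseteq> topspace X" using r(1) unfolding R_def by blast
  have topY: "topspace Y = R"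
    unfolding Y_def topspace_pullback_topology by (auto simp: e_def)
  have openY: "openin Y S \<longleftrightarrow> (\<exists>W. openin ?P W \<and> S = e -` W \<inter> R)" for S
    unfolding Y_def openin_pullback_topology by simp
  have eY: "continuous_map Y ?P e"
    using continuous_map_pullback[of ?P ?P id R e] unfolding Y_def by simp
  have inj: "inj_on e (topspace Y)"
  proof (rule inj_onI)
    fix x y assume "x \<in> topspace Y" "y \<in> topspace Y" and exy: "e x = e y"
    then obtain x' y' where xy: "x' \<in> topspace X" "y' \<in> topspace X" "x = r x'" "y = r y'"
      unfolding topY R_def by blast
    with exy have "e x' = e y'" using r(2) by simp
    from r_eq[OF this] show "x = y" unfolding xy(3,4) .
  qed
  have rY: "continuous_map X Y r"
    unfolding Y_def
  proof (rule continuous_map_pullback')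
    show "continuous_map X ?P (e \<circ> r)"
      by (rule continuous_map_eq[OF e_cont]) (simp add: r(2))
    show "topspace X \<subseteq> r -` R" unfolding R_def by blast
  qed
  have nci: "nowhere_constant_image X Y"
    unfolding nowhere_constant_image_def
  proof (intro exI[of _ r] conjI allI impI)
    fix U assume U: "openin X U \<and> U \<noteq> {}"
    then obtain f x y where f: "f \<in> \<Phi>" "x \<in> U" "y \<in> U" "f x \<noteq> f y" using nonconst by metis
    have "e x f \<noteq> e y f" using f by (simp add: e_def)
    then have "e x \<noteq> e y" by metis
    moreover have "x \<in> topspace X" "y \<in> topspace X" using U f openin_subset by blast+
    ultimately have "r x \<noteq> r y" using r(2) by metis
    then show "\<exists>x\<in>U. \<exists>y\<in>U. r x \<noteq> r y" using f by blast
  qed (use rY topY R_def in auto)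
  have "completely_regular_space ?P"
    by (simp add: completely_regular_space_product_topology metrizable_imp_completely_regular_space
        metrizable_space_euclidean)
  then have "completely_regular_space Y"
    unfolding completely_regular_space_alt'
  proof (intro allI impI)
    fix S x assume P: "\<forall>S x. openin ?P S \<longrightarrow> x \<in> S \<longrightarrow>
        (\<exists>f. continuous_map ?P euclideanreal f \<and> f x = 0 \<and> f ` (topspace ?P - S) \<subseteq> {1})"
      and S: "openin Y S" "x \<in> S"
    obtain W where W: "openin ?P W" "S = e -` W \<inter> R" using S(1) openY by blast
    then obtain f where f: "continuous_map ?P euclideanreal f" "f (e x) = 0" "f ` (topspace ?P - W) \<subseteq> {1}"
      using P S(2) by blast
    have "e y \<in> topspace ?P - W" if "y \<in> topspace Y - S" for y
      using continuous_map_image_subset_topspace[OF eY] that unfolding W(2) topY by blast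
    then have "(f \<circ> e) ` (topspace Y - S) \<subseteq> {1}"
      using f(3) unfolding image_subset_iff by simp
    then show "\<exists>f. continuous_map Y euclideanreal f \<and> f x = 0 \<and> f ` (topspace Y - S) \<subseteq> {1}"
      using continuous_map_compose[OF eY f(1)] f(2) by (intro exI[of _ "f \<circ> e"]) simp
  qed
  moreover have "Hausdorff_space Y"
    by (rule Hausdorff_space_injective_preimage[OF _ eY inj])
       (simp add: Hausdorff_space_product_topology Hausdorff_space_euclidean)
  ultimately have tych: "tychonov_space Y" unfolding tychonov_space_def by blast
  have fY: "continuous_map Y euclideanreal f" if "f \<in> \<Phi>" for f
  proof -
    have "continuous_map Y euclideanreal ((\<lambda>g. g f) \<circ> e)"
      by (rule continuous_map_compose[OF eY continuous_map_product_projection[OF that]])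
    then show ?thesis using that by (simp add: e_def o_def)
  qed
  define box where "box = (\<lambda>(f, a, b). {x :: 'a. of_rat a < (f x :: real) \<and> f x < of_rat b})"
  let ?B = "(\<lambda>K. R \<inter> \<Inter>(box ` K)) ` Fpow (\<Phi> \<times> (UNIV :: (rat \<times> rat) set))"
  have "base_for Y ?B"
    unfolding base_for_def
  proof (intro conjI ballI allI impI)
    fix V assume "V \<in> ?B"
    then obtain K where K: "finite K" "K \<subseteq> \<Phi> \<times> UNIV" "V = R \<inter> \<Inter>(box ` K)"
      unfolding Fpow_def by blast
    have "openin Y (R \<inter> \<Inter>(box ` K))"
      using K(1,2)
    proof (induction K)
      case empty
      then show ?case using topY openin_topspace[of Y] by simp
    next
      case (insert p K)
      obtain f a b where p: "p = (f, a, b)" by (cases p)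
      then have "f \<in> \<Phi>" using insert.prems by blast
      then have "openin Y {x \<in> topspace Y. f x \<in> {of_rat a<..<of_rat b}}"
        by (intro openin_continuous_map_preimage[OF fY]) simp_all
      moreover have "{x \<in> topspace Y. f x \<in> {of_rat a<..<of_rat b}} = R \<inter> box p"
        unfolding topY p box_def by auto
      ultimately have "openin Y ((R \<inter> box p) \<inter> (R \<inter> \<Inter>(box ` K)))"
        using insert by auto
      then show ?case by (simp add: Int_ac)
    qed
    with K show "openin Y V" by simp
  next
    fix U x assume "openin Y U \<and> x \<in> U"
    then obtain W where W: "openin ?P W" "U = e -` W \<inter> R" "x \<in> R" "e x \<in> W"
      using openY by blast
    then obtain V where V: "finite {f \<in> \<Phi>. V f \<noteq> UNIV}" "\<And>f. f \<in> \<Phi> \<Longrightarrow> open (V f)"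
      "e x \<in> Pi\<^sub>E \<Phi> V" "Pi\<^sub>E \<Phi> V \<subseteq> W"
      unfolding openin_product_topology_alt by (auto simp: topspace_euclidean)
    \<comment> \<open>Only the finitely many coordinates restricted by \<open>V\<close> need a
      rational interval; the others impose no condition.\<close>
    define J where "J = {f \<in> \<Phi>. V f \<noteq> UNIV}"
    have "\<exists>a b :: rat. of_rat a < f x \<and> f x < of_rat b \<and> {of_rat a<..<of_rat b} \<subseteq> V f" if f: "f \<in> \<Phi>" for f
    proof -
      have "f x \<in> V f" using V(3) f unfolding e_def by fastforce
      with V(2)[OF f] show ?thesis using open_real_rational_interval by metis
    qed
    then obtain a b :: "('a \<Rightarrow> real) \<Rightarrow> rat" where ab: "\<And>f. f \<in> \<Phi> \<Longrightarrow> of_rat (a f) < f x"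
      "\<And>f. f \<in> \<Phi> \<Longrightarrow> f x < of_rat (b f)" "\<And>f. f \<in> \<Phi> \<Longrightarrow> {of_rat (a f)<..<of_rat (b f)} \<subseteq> V f"
      by metis
    let ?K = "(\<lambda>f. (f, a f, b f)) ` J"
    have K: "?K \<in> Fpow (\<Phi> \<times> UNIV)" using V(1) unfolding J_def Fpow_def by auto
    have x_in: "x \<in> R \<inter> \<Inter>(box ` ?K)" using W(3) ab unfolding box_def J_def by auto
    have sub: "R \<inter> \<Inter>(box ` ?K) \<subseteq> U"
    proof
      fix z assume z: "z \<in> R \<inter> \<Inter>(box ` ?K)"
      have "f z \<in> V f" if f: "f \<in> \<Phi>" for f
      proof (cases "f \<in> J")
        case True
        then have "z \<in> box (f, a f, b f)" using z by blast
        then show ?thesis using ab(3)[OF f] unfolding box_def by auto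
      next
        case False
        then show ?thesis using f unfolding J_def by simp
      qed
      then have "e z \<in> Pi\<^sub>E \<Phi> V" unfolding e_def by auto
      then show "z \<in> U" using V(4) W(2) z by blast
    qed
    from K have "R \<inter> \<Inter>(box ` ?K) \<in> ?B" by (rule imageI)
    then show "\<exists>V\<in>?B. x \<in> V \<and> V \<subseteq> U"
      by (rule bexI[rotated]) (intro conjI x_in sub)
  qed
  then have "weight Y \<le>o |?B|" by (rule weight_least)
  also have "|?B| \<le>o |Fpow (\<Phi> \<times> (UNIV :: (rat \<times> rat) set))|" by (rule card_of_image)
  \<comment> \<open>The summand \<open>nat\<close> absorbs the rational endpoints and keeps the
    bound infinite when \<open>\<Phi>\<close> is finite.\<close>
  also have "|Fpow (\<Phi> \<times> (UNIV :: (rat \<times> rat) set))| \<le>o |\<Phi> <+> (UNIV :: nat set)|"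
  proof (rule card_of_Fpow_ordLeq)
    show inf: "infinite (\<Phi> <+> (UNIV :: nat set))" by (simp add: finite_Plus_iff)
    have "|UNIV :: (rat \<times> rat) set| \<le>o |UNIV :: nat set|"
      using countableI_type[of "UNIV :: (rat \<times> rat) set"] unfolding countable_def card_of_ordLeq[symmetric] by auto
    then have "|UNIV :: (rat \<times> rat) set| \<le>o |\<Phi> <+> (UNIV :: nat set)|"
      using card_of_Plus2 ordLeq_transitive by blast
    then show "|\<Phi> \<times> (UNIV :: (rat \<times> rat) set)| \<le>o |\<Phi> <+> (UNIV :: nat set)|"
      using inf by (intro card_of_Times_ordLeq_infinite_Field)
        (simp_all add: Field_card_of card_of_card_order_on card_of_Plus1)
  qed
  finally show thesis using that tych nci by blast
qed

text \<open>
  A function supported in a member \<open>A\<close> of \<open>\<S>\<close> may vanish on \<open>U \<inter> A\<close>; therefore one takes,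
  for all members at once, a maximal disjoint family of cozero sets refining \<open>\<S>\<close>.
\<close>

lemma ex_functions_for_disjoint_family:
  assumes "completely_regular_space X" and \<S>: "pairwise disjnt \<S>" "\<And>A. A \<in> \<S> \<Longrightarrow> openin X A"
  shows "\<exists>\<Phi>. |\<Phi>| <o hat_c X \<and> (\<forall>f\<in>\<Phi>. continuous_map X euclideanreal f) \<and>
    (\<forall>U. openin X U \<longrightarrow> (\<exists>A\<in>\<S>. \<exists>B\<in>\<S>. A \<noteq> B \<and> U \<inter> A \<noteq> {} \<and> U \<inter> B \<noteq> {}) \<longrightarrow>
      (\<exists>f\<in>\<Phi>. \<exists>x\<in>U. \<exists>y\<in>U. f x \<noteq> f y))"
proof -
  define coz where "coz f = {x \<in> topspace X. f x \<noteq> (0 :: real)}" for f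
  define \<P> where "\<P> = {coz f |f. continuous_map X euclideanreal f \<and> coz f \<noteq> {} \<and> (\<exists>A\<in>\<S>. coz f \<subseteq> A)}"
  obtain \<D> where \<D>: "\<D> \<subseteq> \<P>" "pairwise disjnt \<D>" "\<And>W. W \<in> \<P> \<Longrightarrow> \<exists>V\<in>\<D>. \<not> disjnt W V"
    by (rule maximal_disjoint_subfamily[of \<P>]) (auto simp: \<P>_def)
  have coz_open: "openin X (coz f)" if "continuous_map X euclideanreal f" for f
  proof -
    have "openin X {x \<in> topspace X. f x \<in> - {0}}"
      by (rule openin_continuous_map_preimage[OF that]) auto
    then show ?thesis unfolding coz_def by simp
  qed
  have "cellular_family X \<D>"
    using \<D>(1,2) coz_open unfolding cellular_family_def \<P>_def by blast
  then have less: "|\<D>| <o hat_c X" by (rule cellular_family_less_hat_c)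
  have "\<forall>W\<in>\<D>. \<exists>f. W = coz f \<and> continuous_map X euclideanreal f" using \<D>(1) unfolding \<P>_def by blast
  then obtain h where h: "\<And>W. W \<in> \<D> \<Longrightarrow> W = coz (h W)" "\<And>W. W \<in> \<D> \<Longrightarrow> continuous_map X euclideanreal (h W)"
    by metis
  have split: "\<exists>f\<in>h ` \<D>. \<exists>x\<in>U. \<exists>y\<in>U. f x \<noteq> f y"
    if U: "openin X U" and AB: "A \<in> \<S>" "B \<in> \<S>" "A \<noteq> B" "U \<inter> A \<noteq> {}" "U \<inter> B \<noteq> {}" for U A B
  proof -
    obtain x where x: "x \<in> U \<inter> A" using AB(4) by blast
    have oUA: "openin X (U \<inter> A)" using U \<S>(2)[OF AB(1)] by blast
    then obtain f where f: "continuous_map X euclideanreal f" "f x = 1" "f ` (topspace X - U \<inter> A) \<subseteq> {0}"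
      using assms(1) x unfolding completely_regular_space_gen_alt'[OF one_neq_zero[where 'a=real]] by meson
    have xt: "x \<in> topspace X" using oUA x openin_subset by blast
    have coz: "coz f \<subseteq> U \<inter> A" "x \<in> coz f" using f xt unfolding coz_def by auto
    then have "coz f \<in> \<P>" using f(1) AB(1) unfolding \<P>_def by blast
    \<comment> \<open>The member \<open>W\<close> found by maximality meets
      \<open>U \<inter> A\<close> and lies in a single member of \<open>\<S>\<close>, which must be
      \<open>A\<close>. Hence \<open>h W\<close> is nonzero somewhere in \<open>U\<close> and
      vanishes on \<open>U \<inter> B\<close>.\<close>
    then obtain W where W: "W \<in> \<D>" "coz f \<inter> W \<noteq> {}" using \<D>(3) unfolding disjnt_def by blast
    then obtain A' where A': "A' \<in> \<S>" "W \<subseteq> A'" using \<D>(1) unfolding \<P>_def by blast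
    have "A \<inter> A' \<noteq> {}" using coz W A' by blast
    then have "A' = A" using \<S>(1) AB(1) A'(1) unfolding pairwise_def disjnt_def by blast
    obtain y where y: "y \<in> U" "y \<in> W" using coz W by blast
    obtain z where z: "z \<in> U" "z \<in> B" using AB(5) by blast
    have "A \<inter> B = {}" using \<S>(1) AB unfolding pairwise_def disjnt_def by blast
    then have "z \<notin> W" using z A' \<open>A' = A\<close> by blast
    moreover have "z \<in> topspace X" using z U openin_subset by blast
    ultimately have "h W z = 0" using h(1)[OF W(1)] unfolding coz_def by blast
    moreover have "h W y \<noteq> 0" using y h(1)[OF W(1)] unfolding coz_def by blast
    ultimately show ?thesis using y(1) z(1) W(1) by (metis imageI)
  qed
  show ?thesis
  proof (intro exI[of _ "h ` \<D>"] conjI ballI allI impI)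
    show "|h ` \<D>| <o hat_c X" by (rule ordLeq_ordLess_trans[OF card_of_image less])
    show "continuous_map X euclideanreal f" if "f \<in> h ` \<D>" for f using h(2) that by blast
    show "\<exists>f\<in>h ` \<D>. \<exists>x\<in>U. \<exists>y\<in>U. f x \<noteq> f y"
      if "openin X U" "\<exists>A\<in>\<S>. \<exists>B\<in>\<S>. A \<noteq> B \<and> U \<inter> A \<noteq> {} \<and> U \<inter> B \<noteq> {}" for U
      using that(2) by (elim bexE conjE) (rule split[OF that(1)])
  qed
qed

text \<open>Each member of \<open>\<FF>\<close> contributes fewer than \<open>hat_c X\<close>
  functions. For the weak bound on their union it suffices that \<open>hat_c X\<close> is infinite;
  the strict bound rests on its regularity.\<close>

lemma ex_image_of_shattering_family:
  fixes X :: "'a topology"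
  assumes X: "completely_regular_space X" and unc: "|UNIV :: nat set| <o hat_c X"
    and \<FF>: "shattering_family X \<FF>" and le: "|\<FF>| \<le>o hat_c X"
  obtains Y :: "'a topology" where "tychonov_space Y" "nowhere_constant_image X Y"
    "weight Y \<le>o hat_c X" "|\<FF>| <o hat_c X \<Longrightarrow> weight Y <o hat_c X"
proof -
  let ?k = "hat_c X"
  have C: "Card_order ?k" by (rule hat_c_Card_order)
  have infk: "infinite (Field ?k)"
    using card_of_mono2[OF ordLess_imp_ordLeq[OF unc]] card_of_ordLeq_finite
    by (metis Field_card_of infinite_UNIV_nat)
  define good where "good \<S> \<Phi> \<longleftrightarrow> |\<Phi>| <o ?k \<and> (\<forall>f\<in>\<Phi>. continuous_map X euclideanreal f) \<and>
    (\<forall>U. openin X U \<longrightarrow> (\<exists>A\<in>\<S>. \<exists>B\<in>\<S>. A \<noteq> B \<and> U \<inter> A \<noteq> {} \<and> U \<inter> B \<noteq> {}) \<longrightarrow>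
      (\<exists>f\<in>\<Phi>. \<exists>x\<in>U. \<exists>y\<in>U. f x \<noteq> f y))" for \<S> \<Phi>
  have "\<exists>\<Phi>. good \<S> \<Phi>" if "\<S> \<in> \<FF>" for \<S>
    unfolding good_def
  proof (rule ex_functions_for_disjoint_family[OF X])
    show "pairwise disjnt \<S>" using \<FF> that unfolding shattering_family_def by blast
    have "\<S> \<subseteq> RO_plus X" using \<FF> that unfolding shattering_family_def by blast
    then show "openin X A" if "A \<in> \<S>" for A using that RO_plus_openin by blast
  qed
  then obtain \<Phi> where good: "\<And>\<S>. \<S> \<in> \<FF> \<Longrightarrow> good \<S> (\<Phi> \<S>)" by metis
  have \<Phi>: "|\<Phi> \<S>| <o ?k" "f \<in> \<Phi> \<S> \<Longrightarrow> continuous_map X euclideanreal f" if "\<S> \<in> \<FF>" for \<S> f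
    using good[OF that] unfolding good_def by simp_all
  let ?\<Psi> = "\<Union>\<S>\<in>\<FF>. \<Phi> \<S>"
  obtain Y :: "'a topology" where Y: "tychonov_space Y" "nowhere_constant_image X Y"
    "weight Y \<le>o |?\<Psi> <+> (UNIV :: nat set)|"
  proof (rule ex_nowhere_constant_image[of ?\<Psi> X])
    show "continuous_map X euclideanreal f" if "f \<in> ?\<Psi>" for f using that \<Phi>(2) by blast
    fix U assume U: "openin X U" "U \<noteq> {}"
    then obtain \<S> where \<S>: "\<S> \<in> \<FF>" "\<exists>A\<in>\<S>. \<exists>B\<in>\<S>. A \<noteq> B \<and> U \<inter> A \<noteq> {} \<and> U \<inter> B \<noteq> {}"
      using \<FF> unfolding shattering_family_def by metis
    then have "\<exists>f\<in>\<Phi> \<S>. \<exists>x\<in>U. \<exists>y\<in>U. f x \<noteq> f y"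
      using good[OF \<S>(1)] U(1) unfolding good_def by simp
    then show "\<exists>f\<in>?\<Psi>. \<exists>x\<in>U. \<exists>y\<in>U. f x \<noteq> f y" using \<S>(1) by blast
  qed blast
  have "|?\<Psi>| \<le>o ?k"
    using infk C le \<Phi>(1) ordLess_imp_ordLeq by (intro card_of_UNION_ordLeq_infinite_Field) auto
  then have "|?\<Psi> <+> (UNIV :: nat set)| \<le>o ?k"
    using infk C unc ordLess_imp_ordLeq by (intro card_of_Plus_ordLeq_infinite_Field) auto
  with Y(3) have "weight Y \<le>o ?k" using ordLeq_transitive by blast
  moreover have "weight Y <o ?k" if "|\<FF>| <o ?k"
  proof -
    have "|?\<Psi>| <o ?k" by (rule stable_UNION[OF stable_hat_c[OF unc] that \<Phi>(1)])
    then have "|?\<Psi> <+> (UNIV :: nat set)| <o ?k"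
      using infk C unc by (intro card_of_Plus_ordLess_infinite_Field) auto
    with Y(3) show ?thesis using ordLeq_ordLess_trans by blast
  qed
  ultimately show thesis using that Y(1,2) by blast
qed

section \<open>Assembly, with the empty space treated separately\<close>

theorem theorem3p5:
  fixes X :: "'a topology"
  assumes "crowded_space X" and "tychonov_space X"
  shows
    "(\<exists>Y :: 'a topology. crowded_space Y \<and> tychonov_space Y \<and>
         nowhere_constant_image X Y \<and> weight Y \<le>o hat_c X) \<and>
     (sh X <o hat_c X \<longrightarrow>
       (\<exists>Y :: 'a topology. crowded_space Y \<and> tychonov_space Y \<and>
         nowhere_constant_image X Y \<and> weight Y <o hat_c X)) \<and>
     (no_suslin_trees (hat_c X) \<longrightarrow> sh X <o hat_c X)"
proof (cases "topspace X = {}")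
  case True
  \<comment> \<open>Halving requires a point. In the empty space the empty base and the empty
    shattering family give cardinals below \<open>hat_c X\<close>, and \<open>X\<close> is its own
    image, there being no nonempty open set to test.\<close>
  then have no_open: "U = {}" if "openin X U" for U
    using openin_subset[OF that] by blast
  have less: "|{} :: 'a set set| <o hat_c X"
    by (rule cellular_family_less_hat_c) (simp add: cellular_family_def)
  have "base_for X {}" unfolding base_for_def by (auto dest: no_open)
  then have w: "weight X <o hat_c X" using weight_least less ordLeq_ordLess_trans by blast
  have "shattering_family X {}" unfolding shattering_family_def by (auto dest: no_open)
  then have "sh X \<le>o |{} :: 'a set set set|" by (rule sh_least)
  also have "|{} :: 'a set set set| \<le>o |{} :: 'a set set|" by (rule card_of_empty)
  finally have "sh X <o hat_c X" using less ordLeq_ordLess_trans by blast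
  moreover have "nowhere_constant_image X X"
    unfolding nowhere_constant_image_def by (intro exI[of _ id]) (auto dest: no_open)
  ultimately show ?thesis using assms w ordLess_imp_ordLeq by blast
next
  case False
  obtain H where "halving X H"
    using ex_halving assms False unfolding tychonov_space_def by blast
  then interpret halving X H .
  obtain \<FF> where \<FF>: "shattering_family X \<FF>" "sh X = |\<FF>|" using sh_attained[OF assms] by blast
  have "completely_regular_space X" using assms unfolding tychonov_space_def by blast
  then obtain Y :: "'a topology" where "tychonov_space Y" "nowhere_constant_image X Y"
    "weight Y \<le>o hat_c X" "sh X <o hat_c X \<Longrightarrow> weight Y <o hat_c X"
    using ex_image_of_shattering_family[OF _ nat_less_hat_c \<FF>(1)]
      sh_hat_c_halving(1)[OF halving_axioms] unfolding \<FF>(2) by blast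
  then show ?thesis
    using crowded_space_nowhere_constant_image sh_hat_c_halving(2)[OF halving_axioms] by blast
qed

end
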